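(* Let $V$ be a finite-dimensional real vector space, and let $Q\subset V$ and $P\subset V^*$ be strictly convex closed $C^1$-smooth hypersurfaces, each containing the origin in its interior. Let $\Omega=dq\wedge dp$ be the canonical symplectic structure on $V\times V^*$. Then the Minkowski billiard map $\varphi_M$ associated with $(Q,P)$ is symplectic: it preserves the restriction of $\Omega$ to $Q\times P$.
   Context: A strictly convex closed hypersurface in a finite-dimensional real vector space is the boundary of a compact convex body with nonempty interior, such that the boundary contains no line segment; the "interior" of the hypersurface is the interior of that body. The dot denotes the pairing between $V$ and $V^*$. In dual linear coordinates $(q^i)$ on $V$ and $(p_i)$ on $V^*$, $\Omega=dq\wedge dp=\sum_i dq^i\wedge dp_i$. Legendre transform: for $q\in Q$, $\mathcal L(q)\in V^*$ is the unique covector with $\ker\mathcal L(q)=T_qQ$ and $q\cdot\mathcal L(q)=1$. Similarly, for $p\in P$, $\mathcal L(p)\in V^{**}=V$ is the unique vector with $\ker\mathcal L(p)=T_pP$ (viewing $\mathcal L(p)$ as a linear function on $V^*$) and $\mathcal L(p)\cdot p=1$. Write $a\sim b$ if $a=cb$ for some $c>0$. Minkowski billiard map: the phase space is $\mathcal S=\{(q,p)\mid q\in Q,\ p\in P,\ \mathcal L(q)\cdot\mathcal L(p)<0\}$, an open subset of $Q\times P$, and $\varphi_M:\mathcal S\to\mathcal S$ sends $(q,p)$ to $(q_1,p_1)$, where $q_1\in Q$ and $p_1\in P$ are determined by $q_1-q\sim\mathcal L(p)$ and $p_1-p\sim-\mathcal L(q_1)$.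
   Formalization: For merely C¹-smooth Q and P the billiard map need not be differentiable, so the pullback of Ω may be undefined at some points; preservation of Ω on Q×P is proved at every phase-space point where the map is differentiable. *)

theory Defs
  imports "HOL-Analysis.Analysis"
begin

text \<open>
  The space \<open>V\<close> is modelled by a type of class \<open>euclidean_space\<close>; its inner product serves only
  to fix linear coordinates and the topology.  The dual \<open>V\<^sup>*\<close> is a separate type, and the
  pairing is function application.
\<close>

type_synonym 'v dual = "'v \<Rightarrow>\<^sub>L real"


section \<open>Hypersurfaces\<close>

definition C1_hypersurface :: "'e::real_normed_vector set \<Rightarrow> bool" where
  "C1_hypersurface M \<longleftrightarrow>
    (\<forall>x\<in>M. \<exists>U (f :: 'e \<Rightarrow> real) (f' :: 'e \<Rightarrow> 'e \<Rightarrow>\<^sub>L real).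
       open U \<and> x \<in> U \<and>
       (\<forall>y\<in>U. (f has_derivative blinfun_apply (f' y)) (at y)) \<and>
       continuous_on U f' \<and> (\<forall>y\<in>U. f' y \<noteq> 0) \<and>
       M \<inter> U = {y\<in>U. f y = 0})"

definition tangent_space :: "'e::real_normed_vector set \<Rightarrow> 'e \<Rightarrow> 'e set" where
  "tangent_space M x =
    {v. \<exists>\<gamma> e. e > 0 \<and> \<gamma> C1_differentiable_on {-e<..<e} \<and> \<gamma> ` {-e<..<e} \<subseteq> M \<and>
          \<gamma> 0 = x \<and> (\<gamma> has_vector_derivative v) (at 0)}"

definition convex_body :: "'e::real_normed_vector set \<Rightarrow> bool" where
  "convex_body B \<longleftrightarrow> compact B \<and> convex B \<and> interior B \<noteq> {}"

definition strictly_convex_hypersurface :: "'e::real_normed_vector set \<Rightarrow> bool" where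
  "strictly_convex_hypersurface M \<longleftrightarrow>
    (\<exists>B. convex_body B \<and> frontier B = M) \<and>
    (\<forall>x y. closed_segment x y \<subseteq> M \<longrightarrow> x = y)"

text \<open>A convex body is determined by its boundary, so at most one \<open>B\<close> contributes to the union.\<close>

definition hypersurface_interior :: "'e::real_normed_vector set \<Rightarrow> 'e set" where
  "hypersurface_interior M = (\<Union>B\<in>{B. convex_body B \<and> frontier B = M}. interior B)"


section \<open>Legendre transforms and the billiard map\<close>

definition legendre :: "'v::euclidean_space set \<Rightarrow> 'v \<Rightarrow> 'v dual" where
  "legendre Q q =
    (THE l. {v. blinfun_apply l v = 0} = tangent_space Q q \<and> blinfun_apply l q = 1)"

text \<open>For a hypersurface in \<open>V\<^sup>*\<close> the transform takes values in \<open>V\<^sup>*\<^sup>* = V\<close>, where a vector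
  \<open>v\<close> acts on covectors by evaluation at \<open>v\<close>.\<close>

definition legendre_dual :: "'v::euclidean_space dual set \<Rightarrow> 'v dual \<Rightarrow> 'v" where
  "legendre_dual P p =
    (THE v. {l. blinfun_apply l v = 0} = tangent_space P p \<and> blinfun_apply p v = 1)"

definition pos_multiple :: "'e::real_vector \<Rightarrow> 'e \<Rightarrow> bool" (infix "\<sim>\<^sub>+" 50) where
  "a \<sim>\<^sub>+ b \<longleftrightarrow> (\<exists>c>0. a = c *\<^sub>R b)"

definition phase_space ::
  "'v::euclidean_space set \<Rightarrow> 'v dual set \<Rightarrow> ('v \<times> 'v dual) set" where
  "phase_space Q P =
    {(q, p). q \<in> Q \<and> p \<in> P \<and> blinfun_apply (legendre Q q) (legendre_dual P p) < 0}"

definition minkowski_billiard_map ::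
  "'v::euclidean_space set \<Rightarrow> 'v dual set \<Rightarrow> 'v \<times> 'v dual \<Rightarrow> 'v \<times> 'v dual" where
  "minkowski_billiard_map Q P = (\<lambda>(q, p).
    THE (q\<^sub>1, p\<^sub>1). q\<^sub>1 \<in> Q \<and> p\<^sub>1 \<in> P \<and>
      q\<^sub>1 - q \<sim>\<^sub>+ legendre_dual P p \<and> p\<^sub>1 - p \<sim>\<^sub>+ - legendre Q q\<^sub>1)"


section \<open>The canonical symplectic structure\<close>

text \<open>\<open>\<Omega> = \<Sum>\<^sub>i dq\<^sup>i \<and> dp\<^sub>i\<close>, with \<open>(\<alpha> \<and> \<beta>)(u, w) = \<alpha>(u) \<beta>(w) - \<alpha>(w) \<beta>(u)\<close>; for a basis vector
  \<open>b\<close>, the dual coordinates are \<open>q \<mapsto> q \<bullet> b\<close> and \<open>p \<mapsto> p(b)\<close>.\<close>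

definition canonical_form ::
  "'v::euclidean_space \<times> 'v dual \<Rightarrow> 'v \<times> 'v dual \<Rightarrow> real" where
  "canonical_form u w =
    (\<Sum>b\<in>Basis. (fst u \<bullet> b) * blinfun_apply (snd w) b - (fst w \<bullet> b) * blinfun_apply (snd u) b)"

lemma canonical_form_eq_pairing:
  fixes u w :: "'v::euclidean_space \<times> 'v dual"
  shows "canonical_form u w = blinfun_apply (snd w) (fst u) - blinfun_apply (snd u) (fst w)"
proof -
  have expand: "(\<Sum>b\<in>Basis. (v \<bullet> b) * blinfun_apply l b) = blinfun_apply l v"
    for l :: "'v dual" and v :: 'v
  proof -
    have "(\<Sum>b\<in>Basis. (v \<bullet> b) * blinfun_apply l b) =
        blinfun_apply l (\<Sum>b\<in>Basis. (v \<bullet> b) *\<^sub>R b)"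
      by (simp only: blinfun.sum_right blinfun.scaleR_right real_scaleR_def)
    then show ?thesis
      by (simp only: euclidean_representation)
  qed
  show ?thesis
    by (simp only: canonical_form_def sum_subtractf expand)
qed

text \<open>
  A self-map \<open>\<phi>\<close> of an open subset \<open>S\<close> of a submanifold \<open>M\<close> preserves the restriction of \<open>\<Omega>\<close> to
  \<open>M\<close>: \<open>\<phi>\<^sup>*\<Omega> = \<Omega>\<close> on tangent vectors of \<open>M\<close>.  Differentiability is relative to \<open>S\<close>, so \<open>D\<close> is
  determined only on the tangent space.  The differential is not assumed to exist everywhere, and
  the identity is required at each point where it exists: for hypersurfaces that are only \<open>C\<^sup>1\<close>
  the Legendre transforms, and with them the billiard map, are in general only continuous.
\<close>

definition symplectic_on ::
  "('v::euclidean_space \<times> 'v dual) set \<Rightarrow> ('v \<times> 'v dual) set \<Rightarrow>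
   ('v \<times> 'v dual \<Rightarrow> 'v \<times> 'v dual) \<Rightarrow> bool" where
  "symplectic_on M S \<phi> \<longleftrightarrow>
    \<phi> \<in> S \<rightarrow> S \<and>
    (\<forall>z\<in>S. \<forall>D. (\<phi> has_derivative D) (at z within S) \<longrightarrow>
      (\<forall>u\<in>tangent_space M z. \<forall>w\<in>tangent_space M z.
        canonical_form (D u) (D w) = canonical_form u w))"

end

theory Submission
  imports Defs "HOL-Real_Asymp.Real_Asymp"
begin

text \<open>
  Write \<open>(q\<^sub>1, p\<^sub>1) = \<phi>(q, p)\<close>.  The vector \<open>q\<^sub>1 - q\<close> is an outer normal to \<open>P\<close> at \<open>p\<close>, and the
  covector \<open>p - p\<^sub>1\<close> is an outer normal to \<open>Q\<close> at \<open>q\<^sub>1\<close>.  If an outer normal \<open>r\<close> at a point \<open>x\<close> of a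
  convex hypersurface depends differentiably on a parameter together with \<open>x\<close>, then the bilinear
  form \<open>dr(u) \<cdot> dx(w)\<close> is symmetric.  For the two pairs above this says that \<open>dp \<and> d(q\<^sub>1 - q)\<close> and
  \<open>d(p - p\<^sub>1) \<and> dq\<^sub>1\<close> vanish, hence \<open>dq\<^sub>1 \<and> dp\<^sub>1 = dq\<^sub>1 \<and> dp = dq \<and> dp\<close>.

  Since \<open>\<phi>\<close> is differentiable only at the given point, the symmetry cannot be obtained from second
  derivatives.  Instead, the support inequality \<open>r(x) \<cdot> (x' - x) \<le> 0\<close> is summed along a closed
  polygon of points at distance \<open>O(t)\<close> and divided by \<open>t\<^sup>2\<close>: the limiting form is cyclically
  monotone, and a cyclically monotone bilinear form is symmetric.
\<close>

section \<open>Level sets and tangent spaces\<close>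

lemma mvt_segment:
  fixes f :: "'e::real_normed_vector \<Rightarrow> real"
  assumes "convex S" "y \<in> S" "y' \<in> S"
    and der: "\<And>z. z \<in> S \<Longrightarrow> (f has_derivative blinfun_apply (f' z)) (at z)"
  obtains \<xi> where "\<xi> \<in> closed_segment y y'" "f y' - f y = blinfun_apply (f' \<xi>) (y' - y)"
proof -
  have seg: "closed_segment y y' \<subseteq> S"
    using assms by (simp add: closed_segment_subset)
  have mem: "y + t *\<^sub>R (y' - y) \<in> closed_segment y y'" if "0 \<le> t" "t \<le> 1" for t
    using that by (auto simp: in_segment algebra_simps intro!: exI[of _ t])
  have "\<exists>t\<in>{0<..<1}. (\<lambda>t. f (y + t *\<^sub>R (y' - y))) 1 - (\<lambda>t. f (y + t *\<^sub>R (y' - y))) 0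
      = (\<lambda>s. blinfun_apply (f' (y + t *\<^sub>R (y' - y))) (s *\<^sub>R (y' - y))) (1 - 0)"
  proof (rule mvt_simple)
    fix t :: real assume t: "0 \<le> t" "t \<le> 1"
    have "((\<lambda>t. f (y + t *\<^sub>R (y' - y))) has_derivative
        (\<lambda>s. blinfun_apply (f' (y + t *\<^sub>R (y' - y))) (s *\<^sub>R (y' - y)))) (at t)"
      by (rule has_derivative_compose[OF _ der]) (use mem[OF t] seg in \<open>auto intro!: derivative_eq_intros\<close>)
    then show "((\<lambda>t. f (y + t *\<^sub>R (y' - y))) has_derivative
        (\<lambda>s. blinfun_apply (f' (y + t *\<^sub>R (y' - y))) (s *\<^sub>R (y' - y)))) (at t within {0..1})"
      by (rule has_derivative_at_withinI)
  qed simp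
  then obtain t where "t \<in> {0<..<1}"
    "f y' - f y = blinfun_apply (f' (y + t *\<^sub>R (y' - y))) (y' - y)"
    by auto
  then show ?thesis
    using that[OF mem[of t]] by auto
qed

text \<open>The curve is sought as x + t v + s(t) n with n transverse to the kernel of
  \<open>f' x\<close>. Near x, f is strictly increasing in the direction n, so the intermediate
  value theorem on a line yields s(t). The mean value theorem between two points of the curve turns
  difference quotients of s into -f'(\<xi>) v / f'(\<xi>) n, which gives continuity first and
  differentiability afterwards.\<close>

lemma level_set_curve:
  fixes f :: "'e::real_normed_vector \<Rightarrow> real"
  assumes U: "open U" "x \<in> U"
    and der: "\<And>y. y \<in> U \<Longrightarrow> (f has_derivative blinfun_apply (f' y)) (at y)"
    and cont: "continuous_on U f'"
    and x: "f x = 0" "f' x \<noteq> 0"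
    and v: "blinfun_apply (f' x) v = 0"
  obtains \<gamma> e where "e > 0" "\<gamma> C1_differentiable_on {-e<..<e}" "\<And>t. \<bar>t\<bar> < e \<Longrightarrow> \<gamma> t \<in> U \<and> f (\<gamma> t) = 0"
    "\<gamma> 0 = x" "(\<gamma> has_vector_derivative v) (at 0)"
proof -
  obtain n0 where "blinfun_apply (f' x) n0 \<noteq> 0"
    using x(2) by (metis blinfun_eqI zero_blinfun.rep_eq)
  define n where "n = (1 / blinfun_apply (f' x) n0) *\<^sub>R n0"
  have n: "blinfun_apply (f' x) n = 1"
    using \<open>blinfun_apply (f' x) n0 \<noteq> 0\<close> by (simp add: n_def blinfun.scaleR_right)
  have cf': "isCont f' y" if "y \<in> U" for y
    using cont U(1) that continuous_on_eq_continuous_at by blast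
  have "((\<lambda>y. blinfun_apply (f' y) n) \<longlongrightarrow> 1) (at x)" "((\<lambda>y. blinfun_apply (f' y) v) \<longlongrightarrow> 0) (at x)"
    using cf'[OF U(2)] by (auto simp: isCont_def n[symmetric] v[symmetric] intro!: tendsto_intros)
  then have "\<forall>\<^sub>F y in at x. blinfun_apply (f' y) n > 1/2" "\<forall>\<^sub>F y in at x. \<bar>blinfun_apply (f' y) v\<bar> < 1"
    "\<forall>\<^sub>F y in at x. y \<in> U"
    using order_tendstoD(1)[of _ 1 "at x" "1/2 :: real"] tendsto_rabs_zero[THEN order_tendstoD(2), of _ "at x" 1]
      eventually_at_in_open'[OF U] by auto
  then have ev: "\<forall>\<^sub>F y in at x. blinfun_apply (f' y) n > 1/2 \<and> \<bar>blinfun_apply (f' y) v\<bar> < 1 \<and> y \<in> U"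
    by eventually_elim auto
  then obtain \<delta> where \<delta>: "\<delta> > 0"
    "\<And>y. y \<in> ball x \<delta> \<Longrightarrow> blinfun_apply (f' y) n > 1/2 \<and> \<bar>blinfun_apply (f' y) v\<bar> < 1 \<and> y \<in> U"
  proof -
    obtain \<delta> where "\<delta> > 0" "\<And>y. y \<noteq> x \<Longrightarrow> dist y x < \<delta> \<Longrightarrow>
        blinfun_apply (f' y) n > 1/2 \<and> \<bar>blinfun_apply (f' y) v\<bar> < 1 \<and> y \<in> U"
      using ev by (auto simp: eventually_at)
    \<comment> \<open>The filter \<open>at x\<close> omits x itself; there the bounds hold by the
      exact values 1 and 0 of \<open>f' x\<close> at n and v.\<close>
    then show thesis
      using \<open>\<delta> > 0\<close> n v U(2)
      by (intro that[of \<delta>]; (case_tac "y = x")?) (auto simp: dist_commute)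
  qed
  \<comment> \<open>Small enough that all parameters bounded by \<sigma> stay in the ball; the
    summand 1 keeps the denominator positive.\<close>
  define \<sigma> where "\<sigma> = \<delta> / (2 * (norm v + norm n + 1))"
  have pos: "norm v + norm n + 1 > 0" by (smt (verit) norm_ge_zero)
  have \<sigma>: "\<sigma> > 0" using \<delta>(1) pos by (simp add: \<sigma>_def)
  have inball: "x + t *\<^sub>R v + s *\<^sub>R n \<in> ball x \<delta>" if "\<bar>t\<bar> \<le> \<sigma>" "\<bar>s\<bar> \<le> \<sigma>" for t s
  proof -
    have "norm (t *\<^sub>R v + s *\<^sub>R n) \<le> \<bar>t\<bar> * norm v + \<bar>s\<bar> * norm n"
      by (metis norm_scaleR norm_triangle_ineq)
    also have "\<dots> \<le> \<sigma> * norm v + \<sigma> * norm n"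
      using that by (intro add_mono mult_right_mono) auto
    also have "\<dots> < \<sigma> * (norm v + norm n + 1) * 2"
      using \<sigma> pos by (simp add: algebra_simps add_pos_nonneg add_strict_increasing2)
    also have "\<dots> = \<delta>" using pos by (simp add: \<sigma>_def field_simps)
    finally show ?thesis
      by (metis add.assoc add_diff_cancel_left' dist_commute dist_norm mem_ball)
  qed
  have mv: "\<exists>\<xi>. \<xi> \<in> ball x \<delta> \<and> \<xi> \<in> closed_segment (x + t *\<^sub>R v + s *\<^sub>R n) (x + t' *\<^sub>R v + s' *\<^sub>R n) \<and>
      f (x + t' *\<^sub>R v + s' *\<^sub>R n) - f (x + t *\<^sub>R v + s *\<^sub>R n)
        = (t' - t) * blinfun_apply (f' \<xi>) v + (s' - s) * blinfun_apply (f' \<xi>) n"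
    if "\<bar>t\<bar> \<le> \<sigma>" "\<bar>s\<bar> \<le> \<sigma>" "\<bar>t'\<bar> \<le> \<sigma>" "\<bar>s'\<bar> \<le> \<sigma>" for t s t' s'
  proof -
    have mem: "x + t *\<^sub>R v + s *\<^sub>R n \<in> ball x \<delta>" "x + t' *\<^sub>R v + s' *\<^sub>R n \<in> ball x \<delta>"
      using inball that by blast+
    obtain \<xi> where \<xi>: "\<xi> \<in> closed_segment (x + t *\<^sub>R v + s *\<^sub>R n) (x + t' *\<^sub>R v + s' *\<^sub>R n)"
      "f (x + t' *\<^sub>R v + s' *\<^sub>R n) - f (x + t *\<^sub>R v + s *\<^sub>R n)
        = blinfun_apply (f' \<xi>) (x + t' *\<^sub>R v + s' *\<^sub>R n - (x + t *\<^sub>R v + s *\<^sub>R n))"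
      using mvt_segment[OF convex_ball mem, of f f'] \<delta>(2) der by metis
    moreover have "x + t' *\<^sub>R v + s' *\<^sub>R n - (x + t *\<^sub>R v + s *\<^sub>R n) = (t' - t) *\<^sub>R v + (s' - s) *\<^sub>R n"
      by (simp add: algebra_simps)
    moreover have "\<xi> \<in> ball x \<delta>"
      using \<xi>(1) closed_segment_subset[OF mem convex_ball] by blast
    ultimately show ?thesis
      by (auto simp: blinfun.add_right blinfun.scaleR_right)
  qed
  \<comment> \<open>For |t| < \<tau> the v-term contributes at most \<tau>, while moving by \<sigma>
    along n contributes more than \<sigma>/2 = \<tau>. So f changes sign between s = -\<sigma> and s
    = \<sigma>.\<close>
  define \<tau> where "\<tau> = \<sigma> / 2"
  have \<tau>: "\<tau> > 0" "\<tau> < \<sigma>" using \<sigma> by (auto simp: \<tau>_def)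
  have ex: "\<exists>s. \<bar>s\<bar> \<le> \<sigma> \<and> f (x + t *\<^sub>R v + s *\<^sub>R n) = 0" if t: "\<bar>t\<bar> < \<tau>" for t
  proof -
    have bd: "\<bar>t * blinfun_apply (f' \<xi>) v\<bar> \<le> \<tau>" "\<sigma> * blinfun_apply (f' \<xi>) n > \<tau>" if "\<xi> \<in> ball x \<delta>" for \<xi>
    proof -
      have "\<bar>t\<bar> * \<bar>blinfun_apply (f' \<xi>) v\<bar> \<le> \<tau> * 1"
        by (intro mult_mono) (use \<delta>(2)[OF that] t in auto)
      then show "\<bar>t * blinfun_apply (f' \<xi>) v\<bar> \<le> \<tau>" by (simp add: abs_mult)
      show "\<sigma> * blinfun_apply (f' \<xi>) n > \<tau>"
        using mult_strict_left_mono[of "1/2" "blinfun_apply (f' \<xi>) n" \<sigma>] \<delta>(2)[OF that] \<sigma>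
        by (auto simp: \<tau>_def)
    qed
    obtain \<xi>1 where "\<xi>1 \<in> ball x \<delta>"
      "f (x + t *\<^sub>R v + \<sigma> *\<^sub>R n) = t * blinfun_apply (f' \<xi>1) v + \<sigma> * blinfun_apply (f' \<xi>1) n"
      using mv[of 0 0 t \<sigma>] t \<tau> x by auto
    then have 1: "f (x + t *\<^sub>R v + \<sigma> *\<^sub>R n) \<ge> 0" using bd[of \<xi>1] by linarith
    obtain \<xi>2 where "\<xi>2 \<in> ball x \<delta>"
      "f (x + t *\<^sub>R v + (-\<sigma>) *\<^sub>R n) = t * blinfun_apply (f' \<xi>2) v - \<sigma> * blinfun_apply (f' \<xi>2) n"
      using mv[of 0 0 t "-\<sigma>"] t \<tau> x by auto
    then have 2: "f (x + t *\<^sub>R v + (-\<sigma>) *\<^sub>R n) \<le> 0" using bd[of \<xi>2] by linarith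
    have "continuous_on {-\<sigma>..\<sigma>} (\<lambda>s. f (x + t *\<^sub>R v + s *\<^sub>R n))"
    proof (rule continuous_on_compose2[of "ball x \<delta>" f])
      show "continuous_on (ball x \<delta>) f"
        using der \<delta>(2) by (meson continuous_at_imp_continuous_on has_derivative_continuous)
      show "(\<lambda>s. x + t *\<^sub>R v + s *\<^sub>R n) ` {-\<sigma>..\<sigma>} \<subseteq> ball x \<delta>"
        by (rule image_subsetI, rule inball) (use t \<tau> in auto)
    qed (intro continuous_intros)
    then show ?thesis
      using IVT'[of "\<lambda>s. f (x + t *\<^sub>R v + s *\<^sub>R n)" "-\<sigma>" 0 \<sigma>] 1 2 \<sigma> by (auto simp: abs_le_iff)
  qed
  \<comment> \<open>An arbitrary choice of zeros suffices: the identity \<open>diff\<close> below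
    holds for any two of them and forces regularity.\<close>
  define s where "s t = (SOME s. \<bar>s\<bar> \<le> \<sigma> \<and> f (x + t *\<^sub>R v + s *\<^sub>R n) = 0)" for t
  have s: "\<bar>s t\<bar> \<le> \<sigma>" "f (x + t *\<^sub>R v + s t *\<^sub>R n) = 0" if "\<bar>t\<bar> < \<tau>" for t
    using someI_ex[OF ex[OF that]] by (auto simp: s_def)
  define c where "c t = x + t *\<^sub>R v + s t *\<^sub>R n" for t
  have c: "c t \<in> ball x \<delta>" "f (c t) = 0" "c t \<in> U" if "\<bar>t\<bar> < \<tau>" for t
    using s[OF that] inball[of t "s t"] \<delta>(2)[of "c t"] that \<tau> by (auto simp: c_def simp del: mem_ball)
  have s0: "s 0 = 0"
  proof -
    obtain \<xi> where "\<xi> \<in> ball x \<delta>" "s 0 * blinfun_apply (f' \<xi>) n = 0"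
      using mv[of 0 0 0 "s 0"] s[of 0] x \<tau> \<sigma> by auto
    then show ?thesis using \<delta>(2)[of \<xi>] by auto
  qed
  have diff: "\<exists>\<xi>. \<xi> \<in> ball x \<delta> \<and> \<xi> \<in> closed_segment (c t) (c t') \<and>
      s t' - s t = - (blinfun_apply (f' \<xi>) v / blinfun_apply (f' \<xi>) n) * (t' - t)"
    if tt: "\<bar>t\<bar> < \<tau>" "\<bar>t'\<bar> < \<tau>" for t t'
  proof -
    obtain \<xi> where \<xi>: "\<xi> \<in> ball x \<delta>" "\<xi> \<in> closed_segment (c t) (c t')"
      "0 = (t' - t) * blinfun_apply (f' \<xi>) v + (s t' - s t) * blinfun_apply (f' \<xi>) n"
      using mv[of t "s t" t' "s t'"] s[of t] s[of t'] tt \<tau> by (auto simp: c_def)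
    moreover have "blinfun_apply (f' \<xi>) n > 0" using \<delta>(2)[OF \<xi>(1)] by linarith
    ultimately have "s t' - s t = - ((t' - t) * blinfun_apply (f' \<xi>) v) / blinfun_apply (f' \<xi>) n"
      by (subst nonzero_eq_divide_eq) linarith+
    then show ?thesis using \<xi>(1,2) by (intro exI[of _ \<xi>]) (simp add: mult.commute)
  qed
  have lip: "\<bar>s t' - s t\<bar> \<le> 2 * \<bar>t' - t\<bar>" if tt: "\<bar>t\<bar> < \<tau>" "\<bar>t'\<bar> < \<tau>" for t t'
  proof -
    obtain \<xi> where \<xi>: "\<xi> \<in> ball x \<delta>"
      "s t' - s t = - (blinfun_apply (f' \<xi>) v / blinfun_apply (f' \<xi>) n) * (t' - t)"
      using diff[OF tt] by blast
    \<comment> \<open>The constant 2 comes from the numerator bound 1 and the denominator bound 1/2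
      on the ball.\<close>
    have "\<bar>blinfun_apply (f' \<xi>) v / blinfun_apply (f' \<xi>) n\<bar> \<le> 2"
      using \<delta>(2)[OF \<xi>(1)] by (auto simp: abs_divide divide_simps)
    then show ?thesis unfolding \<xi>(2) abs_mult abs_minus by (rule mult_right_mono) simp
  qed
  have conts: "isCont s t" if "\<bar>t\<bar> < \<tau>" for t
  proof -
    have "\<forall>\<^sub>F t' in at t. t' \<in> {-\<tau><..<\<tau>}"
      by (rule eventually_at_in_open') (use that in auto)
    then have "\<forall>\<^sub>F t' in at t. norm (s t' - s t) \<le> 2 * \<bar>t' - t\<bar>"
      by eventually_elim (use lip that in auto)
    moreover have "((\<lambda>t'. 2 * \<bar>t' - t\<bar>) \<longlongrightarrow> 0) (at t)"
      by (auto intro!: tendsto_eq_intros)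
    ultimately have "((\<lambda>t'. s t' - s t) \<longlongrightarrow> 0) (at t)" by (rule Lim_null_comparison)
    then show ?thesis by (simp add: isCont_def LIM_zero_iff)
  qed
  have contc: "isCont c t" if "\<bar>t\<bar> < \<tau>" for t
    unfolding c_def using conts[OF that] by (intro continuous_intros)
  define s' where "s' t = - (blinfun_apply (f' (c t)) v / blinfun_apply (f' (c t)) n)" for t
  have ders: "(s has_field_derivative s' t) (at t)" if t: "\<bar>t\<bar> < \<tau>" for t
  proof -
    obtain \<xi> where \<xi>: "\<And>t'. \<bar>t'\<bar> < \<tau> \<Longrightarrow> \<xi> t' \<in> closed_segment (c t) (c t') \<and>
      s t' - s t = - (blinfun_apply (f' (\<xi> t')) v / blinfun_apply (f' (\<xi> t')) n) * (t' - t)"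
      using diff[OF t] by metis
    have ev: "\<forall>\<^sub>F t' in at t. t' \<in> {-\<tau><..<\<tau>}"
      by (rule eventually_at_in_open') (use t in auto)
    \<comment> \<open>The mean value point lies between c(t) and c(t'), so continuity of c squeezes
      it to c(t).\<close>
    have "((\<lambda>t'. \<xi> t' - c t) \<longlongrightarrow> 0) (at t)"
    proof (rule Lim_null_comparison)
      show "\<forall>\<^sub>F t' in at t. norm (\<xi> t' - c t) \<le> norm (c t' - c t)"
        using ev
      proof eventually_elim
        case (elim t')
        then have "\<xi> t' \<in> closed_segment (c t) (c t')" using \<xi>[of t'] by auto
        then show ?case by (rule segment_bound1)
      qed
      show "((\<lambda>t'. norm (c t' - c t)) \<longlongrightarrow> 0) (at t)"
        using contc[OF t] by (simp add: isCont_def LIM_zero_iff tendsto_norm_zero)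
    qed
    then have "((\<lambda>t'. f' (\<xi> t')) \<longlongrightarrow> f' (c t)) (at t)"
      by (intro isCont_tendsto_compose[OF cf'[OF c(3)[OF t]]]) (simp add: LIM_zero_iff)
    then have "((\<lambda>t'. - (blinfun_apply (f' (\<xi> t')) v / blinfun_apply (f' (\<xi> t')) n)) \<longlongrightarrow> s' t) (at t)"
      unfolding s'_def using \<delta>(2)[OF c(1)[OF t]] by (intro tendsto_intros) auto
    moreover have "\<forall>\<^sub>F t' in at t. - (blinfun_apply (f' (\<xi> t')) v / blinfun_apply (f' (\<xi> t')) n)
        = (s t' - s t) / (t' - t)"
      using ev eventually_neq_at_within[of t t UNIV] by eventually_elim (use \<xi> in auto)
    ultimately show ?thesis
      unfolding has_field_derivative_iff by (rule Lim_transform_eventually)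
  qed
  have derc: "(c has_vector_derivative (v + s' t *\<^sub>R n)) (at t)" if t: "\<bar>t\<bar> < \<tau>" for t
    unfolding c_def
    by (rule derivative_eq_intros ders[OF t] refl | simp)+
  show ?thesis
  proof (rule that[of \<tau> c])
    have "continuous_on {-\<tau><..<\<tau>} (\<lambda>t. v + s' t *\<^sub>R n)"
    proof -
      have "isCont (\<lambda>t. f' (c t)) t" if "\<bar>t\<bar> < \<tau>" for t
        using isCont_o2[OF contc cf'] c that by blast
      moreover have "blinfun_apply (f' (c t)) n \<noteq> 0" if "\<bar>t\<bar> < \<tau>" for t
        using \<delta>(2)[OF c(1)[OF that]] by auto
      ultimately show ?thesis
        unfolding s'_def
        by (intro continuous_at_imp_continuous_on ballI continuous_intros) auto
    qed
    then show "c C1_differentiable_on {-\<tau><..<\<tau>}"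
      unfolding C1_differentiable_on_def using derc by (intro exI[of _ "\<lambda>t. v + s' t *\<^sub>R n"]) auto
    show "(c has_vector_derivative v) (at 0)"
      using derc[of 0] \<tau> v s0 by (simp add: s'_def c_def)
  qed (use c \<tau> s0 in \<open>auto simp: c_def\<close>)
qed

text \<open>One inclusion differentiates f along a curve in M, where f vanishes; the other is
  \<open>level_set_curve\<close>. This replaces the tangent space defined by curves with a kernel,
  hence with a linear object.\<close>

lemma tangent_space_level_set:
  fixes f :: "'e::real_normed_vector \<Rightarrow> real"
  assumes U: "open U" "x \<in> U"
    and der: "\<And>y. y \<in> U \<Longrightarrow> (f has_derivative blinfun_apply (f' y)) (at y)"
    and cont: "continuous_on U f'"
    and x: "x \<in> M" "f' x \<noteq> 0"
    and M: "M \<inter> U = {y\<in>U. f y = 0}"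
  shows "tangent_space M x = {v. blinfun_apply (f' x) v = 0}"
proof (intro equalityI subsetI CollectI)
  fix v assume "v \<in> tangent_space M x"
  then obtain \<gamma> e where \<gamma>: "e > 0" "\<gamma> ` {-e<..<e} \<subseteq> M" "\<gamma> 0 = x" "(\<gamma> has_vector_derivative v) (at 0)"
    by (auto simp: tangent_space_def)
  have "((\<lambda>t. f (\<gamma> t)) has_derivative (\<lambda>t. blinfun_apply (f' x) (t *\<^sub>R v))) (at 0)"
    using has_derivative_compose[OF \<gamma>(4)[unfolded has_vector_derivative_def] der[of "\<gamma> 0"]] \<gamma> U(2) by simp
  moreover have "((\<lambda>t. f (\<gamma> t)) has_derivative (\<lambda>t. 0)) (at 0)"
  proof (rule has_derivative_transform_eventually)
    have "\<forall>\<^sub>F t in at 0. \<gamma> t \<in> U"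
      using has_vector_derivative_continuous[OF \<gamma>(4)] topological_tendstoD[of \<gamma> "\<gamma> 0" "at 0" U] U \<gamma>(3)
      by (auto simp: isCont_def)
    moreover have "\<forall>\<^sub>F t in at 0. t \<in> {-e<..<e}"
      by (rule eventually_at_in_open') (use \<gamma> in auto)
    ultimately show "\<forall>\<^sub>F t in at 0. 0 = f (\<gamma> t)"
      proof eventually_elim
        case (elim t)
        then have "\<gamma> t \<in> M \<inter> U" using \<gamma>(2) by blast
        then show ?case using M by simp
      qed
    show "0 = f (\<gamma> 0)" using x M U \<gamma>(3) by auto
    show "((\<lambda>_. 0) has_derivative (\<lambda>t. 0)) (at (0::real))" by simp
  qed auto
  ultimately have "(\<lambda>t. blinfun_apply (f' x) (t *\<^sub>R v)) = (\<lambda>t. 0)"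
    by (rule has_derivative_unique)
  then show "blinfun_apply (f' x) v = 0"
    by (metis scaleR_one)
next
  fix v assume "v \<in> {v. blinfun_apply (f' x) v = 0}"
  then have v: "blinfun_apply (f' x) v = 0" by simp
  have "f x = 0" using M x U by auto
  obtain \<gamma> e where "e > 0" "\<gamma> C1_differentiable_on {-e<..<e}" "\<And>t. \<bar>t\<bar> < e \<Longrightarrow> \<gamma> t \<in> U \<and> f (\<gamma> t) = 0"
    "\<gamma> 0 = x" "(\<gamma> has_vector_derivative v) (at 0)"
    using level_set_curve[OF U der cont \<open>f x = 0\<close> x(2) v] by blast
  then show "v \<in> tangent_space M x"
    unfolding tangent_space_def
  proof (intro CollectI exI[of _ \<gamma>] exI[of _ e] conjI)
    show "\<gamma> ` {-e<..<e} \<subseteq> M"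
    proof
      fix y assume "y \<in> \<gamma> ` {-e<..<e}"
      then have "y \<in> {y\<in>U. f y = 0}"
        using \<open>\<And>t. \<bar>t\<bar> < e \<Longrightarrow> \<gamma> t \<in> U \<and> f (\<gamma> t) = 0\<close> by auto
      then show "y \<in> M" using M by blast
    qed
  qed
qed

lemma has_vector_derivative_imp_quotient:
  fixes g :: "real \<Rightarrow> 'a::real_normed_vector"
  assumes "(g has_vector_derivative d) (at 0)"
  shows "((\<lambda>t. (g t - g 0) /\<^sub>R t) \<longlongrightarrow> d) (at 0)"
proof -
  have "((\<lambda>t. norm (g t - g 0 - t *\<^sub>R d) / norm t) \<longlongrightarrow> 0) (at 0)"
    using assms by (simp add: has_vector_derivative_def has_derivative_iff_norm)
  moreover have "\<forall>\<^sub>F t in at 0. norm (g t - g 0 - t *\<^sub>R d) / norm t = norm ((g t - g 0) /\<^sub>R t - d)"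
  proof -
    have "norm (g t - g 0 - t *\<^sub>R d) / norm t = norm ((g t - g 0) /\<^sub>R t - d)" if "t \<noteq> 0" for t
    proof -
      have "(g t - g 0) /\<^sub>R t - d = (g t - g 0 - t *\<^sub>R d) /\<^sub>R t"
        using that by (simp add: scaleR_right_diff_distrib)
      then show ?thesis by (simp add: divide_inverse mult.commute)
    qed
    then show ?thesis using eventually_neq_at_within[of 0 0 UNIV] by (auto elim: eventually_mono)
  qed
  ultimately have "((\<lambda>t. norm ((g t - g 0) /\<^sub>R t - d)) \<longlongrightarrow> 0) (at 0)"
    by (rule Lim_transform_eventually)
  then show ?thesis by (simp add: LIM_zero_iff tendsto_norm_zero_iff)
qed

section \<open>Smooth convex bodies\<close>

text \<open>The formula of \<open>legendre\<close> over an arbitrary normed space, so that one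
  theory covers Q in V and P in the dual. For P its values lie in the bidual and are later
  identified with vectors.\<close>

definition conormal :: "'e::real_normed_vector set \<Rightarrow> 'e \<Rightarrow> 'e \<Rightarrow>\<^sub>L real" where
  "conormal M x = (THE l. {v. blinfun_apply l v = 0} = tangent_space M x \<and> blinfun_apply l x = 1)"

lemma legendre_eq_conormal: "legendre Q q = conormal Q q"
  by (simp add: legendre_def conormal_def)

text \<open>The vector v - l(v) x lies in the common kernel, so l' takes the value l(v) at v. This
  makes the definite description in \<open>conormal\<close> unambiguous.\<close>

lemma normalized_functional_unique:
  fixes l l' :: "'e::real_normed_vector \<Rightarrow>\<^sub>L real"
  assumes "{v. blinfun_apply l v = 0} = {v. blinfun_apply l' v = 0}"
    and "blinfun_apply l x = 1" "blinfun_apply l' x = 1"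
  shows "l = l'"
proof (rule blinfun_eqI)
  fix v
  have "blinfun_apply l (v - blinfun_apply l v *\<^sub>R x) = 0"
    using assms by (simp add: blinfun.diff_right blinfun.scaleR_right)
  then have "blinfun_apply l' (v - blinfun_apply l v *\<^sub>R x) = 0"
    using assms(1) by auto
  then show "blinfun_apply l v = blinfun_apply l' v"
    using assms by (simp add: blinfun.diff_right blinfun.scaleR_right)
qed

text \<open>For a > 0 the affine map that sends w to (1 - a) y + a w is open, and it maps the
  interior into B by convexity; its image is thus an open subset of B.\<close>

lemma convex_combination_interior:
  fixes B :: "'e::real_normed_vector set"
  assumes "convex B" "y \<in> B" "e \<in> interior B" "0 < a" "a \<le> 1"
  shows "(1 - a) *\<^sub>R y + a *\<^sub>R e \<in> interior B"
proof -
  have "(\<lambda>w. (1 - a) *\<^sub>R y + a *\<^sub>R w) ` interior B \<subseteq> interior B"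
  proof (rule interior_maximal)
    show "(\<lambda>w. (1 - a) *\<^sub>R y + a *\<^sub>R w) ` interior B \<subseteq> B"
      using assms interior_subset[of B] by (auto intro!: convexD)
    show "open ((\<lambda>w. (1 - a) *\<^sub>R y + a *\<^sub>R w) ` interior B)"
      using assms by (intro open_affinity) auto
  qed
  then show ?thesis using assms by auto
qed

lemma eventually_pos_less_at_right_0: "c > 0 \<Longrightarrow> \<forall>\<^sub>F t in at_right (0::real). 0 < t \<and> t < c"
  using eventually_at_right_real[of 0 c] by simp

locale smooth_convex_body =
  fixes B :: "'e::real_normed_vector set"
  assumes closed: "closed B" and bounded: "bounded B" and convex: "convex B"
    and zero_interior: "0 \<in> interior B" and smooth: "C1_hypersurface (frontier B)"
begin

abbreviation "M \<equiv> frontier B"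

lemma M_subset: "M \<subseteq> B"
  using closed by (rule frontier_subset_closed)

lemma M_iff: "x \<in> M \<longleftrightarrow> x \<in> B \<and> x \<notin> interior B"
  using closed by (simp add: frontier_def)

text \<open>Moving from \<open>x\<close> towards a point of the body and, in addition, strictly towards \<open>0\<close> leads into
  the interior, to first order; a curve in the frontier cannot do this.\<close>

lemma inward_not_tangent:
  assumes x: "x \<in> M" and y: "y \<in> B" and a: "a > 0"
  shows "y - x - a *\<^sub>R x \<notin> tangent_space M x"
proof
  assume "y - x - a *\<^sub>R x \<in> tangent_space M x"
  then obtain \<gamma> e where \<gamma>: "e > 0" "\<gamma> ` {-e<..<e} \<subseteq> M" "\<gamma> 0 = x"
    "(\<gamma> has_vector_derivative (y - x - a *\<^sub>R x)) (at 0)"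
    by (auto simp: tangent_space_def)
  \<comment> \<open>Here \<gamma>(t) = x + t (y - x - a x) + t a r(t). Scaling the error by 1/a lets
    it enter with weight t a, as a point near 0 and so in the interior.\<close>
  define r where "r t = (1/a) *\<^sub>R ((\<gamma> t - \<gamma> 0) /\<^sub>R t - (y - x - a *\<^sub>R x))" for t
  have "(r \<longlongrightarrow> (1/a) *\<^sub>R ((y - x - a *\<^sub>R x) - (y - x - a *\<^sub>R x))) (at 0)"
    unfolding r_def by (intro tendsto_intros has_vector_derivative_imp_quotient[OF \<gamma>(4)])
  then have "(r \<longlongrightarrow> 0) (at_right 0)"
    by (simp add: filterlim_at_split)
  then have "\<forall>\<^sub>F t in at_right 0. r t \<in> interior B"
    by (rule topological_tendstoD) (use zero_interior in auto)
  moreover have "\<forall>\<^sub>F t in at_right 0. 0 < t \<and> t < e" "\<forall>\<^sub>F t in at_right 0. 0 < t \<and> t < 1 / (1 + a)"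
    using \<gamma> a by (auto intro!: eventually_pos_less_at_right_0)
  ultimately have "\<forall>\<^sub>F t in at_right (0::real). False"
  proof eventually_elim
    case (elim t)
    have t: "t + t * a < 1" "t > 0" "t * a > 0" "t * a < 1"
      using elim a by (auto simp: field_simps)
    \<comment> \<open>Chosen so that \<gamma>(t) = (1 - t a) z + t a r(t); the bound t < 1/(1 + a)
      keeps the weight of x positive.\<close>
    define z where "z = ((1 - t - t * a) / (1 - t * a)) *\<^sub>R x + (t / (1 - t * a)) *\<^sub>R y"
    have "(1 - t - t * a) / (1 - t * a) + t / (1 - t * a) = 1"
      using t by (simp add: add_divide_distrib[symmetric])
    then have "z \<in> B"
      unfolding z_def using x y M_subset t convex by (intro convexD) auto
    then have "(1 - t * a) *\<^sub>R z + (t * a) *\<^sub>R r t \<in> interior B"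
      by (intro convex_combination_interior) (use t elim convex in auto)
    moreover have "(1 - t * a) *\<^sub>R z = (1 - t - t * a) *\<^sub>R x + t *\<^sub>R y"
      using t by (simp add: z_def scaleR_add_right)
    moreover have "(t * a) *\<^sub>R r t = \<gamma> t - x - t *\<^sub>R (y - x - a *\<^sub>R x)"
      using t a \<gamma>(3) by (simp add: r_def scaleR_diff_right)
    ultimately have "(1 - t - t * a) *\<^sub>R x + t *\<^sub>R y + (\<gamma> t - x - t *\<^sub>R (y - x - a *\<^sub>R x)) \<in> interior B"
      by simp
    then have "\<gamma> t \<in> interior B"
      by (simp add: algebra_simps)
    moreover have "\<gamma> t \<in> M" using \<gamma>(2) elim by auto
    ultimately show False by (simp add: M_iff)
  qed
  then show False by simp
qed

text \<open>If f'(y) vanished at y, then -y would be tangent at y, although it points straight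
  towards the interior point 0. Transversality to the position vector is what permits the
  normalization to 1.\<close>

lemma local_equation:
  assumes "x \<in> M"
  obtains U and f' :: "'e \<Rightarrow> 'e \<Rightarrow>\<^sub>L real" where "open U" "x \<in> U" "continuous_on U f'"
    "\<And>y. y \<in> M \<inter> U \<Longrightarrow> tangent_space M y = {v. blinfun_apply (f' y) v = 0}"
    "\<And>y. y \<in> M \<inter> U \<Longrightarrow> blinfun_apply (f' y) y \<noteq> 0"
proof -
  obtain U f and f' :: "'e \<Rightarrow> 'e \<Rightarrow>\<^sub>L real" where U: "open U" "x \<in> U"
    "\<And>y. y \<in> U \<Longrightarrow> (f has_derivative blinfun_apply (f' y)) (at y)"
    "continuous_on U f'" "\<forall>y\<in>U. f' y \<noteq> 0" "M \<inter> U = {y\<in>U. f y = 0}"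
    using smooth[unfolded C1_hypersurface_def, rule_format, OF assms] by blast
  have T: "tangent_space M y = {v. blinfun_apply (f' y) v = 0}" if "y \<in> M \<inter> U" for y
    by (rule tangent_space_level_set[OF U(1) _ U(3,4) _ _ U(6)]) (use that U(5) in auto)
  moreover have "blinfun_apply (f' y) y \<noteq> 0" if y: "y \<in> M \<inter> U" for y
  proof
    assume "blinfun_apply (f' y) y = 0"
    then have "y - y - 1 *\<^sub>R y \<in> tangent_space M y"
      using T[OF y] by (simp add: blinfun.minus_right)
    then show False using inward_not_tangent[of y y 1] y M_subset by auto
  qed
  ultimately show ?thesis using that U by blast
qed

lemma conormal_eqI:
  assumes "{v. blinfun_apply l v = 0} = tangent_space M x" "blinfun_apply l x = 1"
  shows "conormal M x = l"
  unfolding conormal_def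
proof (rule the_equality)
  show "{v. blinfun_apply l v = 0} = tangent_space M x \<and> blinfun_apply l x = 1"
    using assms by blast
  show "l' = l" if "{v. blinfun_apply l' v = 0} = tangent_space M x \<and> blinfun_apply l' x = 1" for l'
    using that assms by (intro normalized_functional_unique[of l' l x]) auto
qed

lemma conormal_local:
  assumes "y \<in> M" "tangent_space M y = {v. blinfun_apply k v = 0}" "blinfun_apply k y \<noteq> 0"
  shows "conormal M y = k /\<^sub>R blinfun_apply k y"
  by (rule conormal_eqI) (use assms in \<open>auto simp: blinfun.scaleR_left\<close>)

lemma conormal:
  assumes "x \<in> M"
  shows "tangent_space M x = {v. blinfun_apply (conormal M x) v = 0}" "blinfun_apply (conormal M x) x = 1"
proof -
  obtain U and f' :: "'e \<Rightarrow> 'e \<Rightarrow>\<^sub>L real" where U: "x \<in> U"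
    "\<And>y. y \<in> M \<inter> U \<Longrightarrow> tangent_space M y = {v. blinfun_apply (f' y) v = 0}"
    "\<And>y. y \<in> M \<inter> U \<Longrightarrow> blinfun_apply (f' y) y \<noteq> 0"
    using local_equation[OF assms] by metis
  have "conormal M x = f' x /\<^sub>R blinfun_apply (f' x) x"
    using conormal_local assms U by blast
  then show "tangent_space M x = {v. blinfun_apply (conormal M x) v = 0}" "blinfun_apply (conormal M x) x = 1"
    using U(2,3)[of x] U(1) assms by (auto simp: blinfun.scaleR_left)
qed

lemma tangent_curve:
  assumes "x \<in> M" "blinfun_apply (conormal M x) v = 0"
  obtains \<gamma> where "\<gamma> 0 = x" "(\<gamma> has_vector_derivative v) (at 0)" "\<forall>\<^sub>F t in at 0. \<gamma> t \<in> M"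
proof -
  have "v \<in> tangent_space M x" using assms conormal by simp
  then obtain \<gamma> e where \<gamma>: "e > 0" "\<gamma> ` {-e<..<e} \<subseteq> M" "\<gamma> 0 = x" "(\<gamma> has_vector_derivative v) (at 0)"
    by (auto simp: tangent_space_def)
  have "\<forall>\<^sub>F t in at 0. t \<in> {-e<..<e}"
    by (rule eventually_at_in_open') (use \<gamma> in auto)
  then have "\<forall>\<^sub>F t in at 0. \<gamma> t \<in> M"
    by eventually_elim (use \<gamma>(2) in blast)
  then show ?thesis using that \<gamma> by blast
qed

text \<open>Locally the conormal is f'(y) / f'(y)(y), a quotient of continuous functions. Continuity
  later keeps curves inside the phase space.\<close>

lemma continuous_on_conormal: "continuous_on M (conormal M)"
  unfolding continuous_on_def
proof
  fix x assume x: "x \<in> M"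
  obtain U and f' :: "'e \<Rightarrow> 'e \<Rightarrow>\<^sub>L real" where U: "open U" "x \<in> U" "continuous_on U f'"
    "\<And>y. y \<in> M \<inter> U \<Longrightarrow> tangent_space M y = {v. blinfun_apply (f' y) v = 0}"
    "\<And>y. y \<in> M \<inter> U \<Longrightarrow> blinfun_apply (f' y) y \<noteq> 0"
    using local_equation[OF x] by metis
  have "continuous_on (M \<inter> U) (\<lambda>y. f' y /\<^sub>R blinfun_apply (f' y) y)"
    using U(3,5) by (intro continuous_intros) (auto intro: continuous_on_subset)
  then have "continuous_on (M \<inter> U) (conormal M)"
    by (rule continuous_on_eq) (use U conormal_local in auto)
  then have "(conormal M \<longlongrightarrow> conormal M x) (at x within M \<inter> U)"
    using x U(2) by (auto simp: continuous_on_def)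
  moreover have "at x within M = at x within M \<inter> U"
    by (rule at_within_nhd[OF U(2,1)]) auto
  ultimately show "(conormal M \<longlongrightarrow> conormal M x) (at x within M)" by simp
qed

text \<open>If the value at y were 1 + a with a > 0, then y - x - a x would lie in the kernel and be
  tangent, against \<open>inward_not_tangent\<close>. The conormal is thereby a support functional
  of the body.\<close>

lemma conormal_le_1:
  assumes x: "x \<in> M" and y: "y \<in> B"
  shows "blinfun_apply (conormal M x) y \<le> 1"
proof (rule ccontr)
  assume *: "\<not> blinfun_apply (conormal M x) y \<le> 1"
  have "y - x - (blinfun_apply (conormal M x) y - 1) *\<^sub>R x \<in> tangent_space M x"
    using conormal[OF x] by (simp add: blinfun.diff_right blinfun.scaleR_right)
  then show False using inward_not_tangent[OF x y] * by auto
qed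

text \<open>An interior point can be pushed slightly in the direction x within B, which raises the
  value of the functional.\<close>

lemma conormal_less_1:
  assumes x: "x \<in> M" and y: "y \<in> interior B"
  shows "blinfun_apply (conormal M x) y < 1"
proof -
  have "((\<lambda>t. y + t *\<^sub>R x) \<longlongrightarrow> y + 0 *\<^sub>R x) (at_right 0)"
    by (intro tendsto_intros)
  then have "\<forall>\<^sub>F t in at_right 0. y + t *\<^sub>R x \<in> interior B"
    by (rule topological_tendstoD) (use y in auto)
  moreover have "\<forall>\<^sub>F t in at_right (0::real). 0 < t \<and> t < 1"
    by (rule eventually_pos_less_at_right_0) simp
  ultimately have "\<forall>\<^sub>F t in at_right 0. y + t *\<^sub>R x \<in> interior B \<and> 0 < t"
    by eventually_elim auto
  then obtain t where "y + t *\<^sub>R x \<in> interior B" "0 < t"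
    using eventually_happens'[OF trivial_limit_at_right_real] by blast
  then show ?thesis
    using conormal_le_1[OF x, of "y + t *\<^sub>R x"] conormal[OF x] interior_subset[of B]
    by (auto simp: blinfun.add_right blinfun.scaleR_right)
qed

section \<open>Rays through a body and their exit points\<close>

text \<open>With c the negated value of the conormal at v, the vector v + c x is tangent. Following
  its curve in the frontier and then contracting towards 0 realizes v with interior
  endpoints.\<close>

lemma inward_enters_interior:
  assumes x: "x \<in> M" and v: "blinfun_apply (conormal M x) v < 0"
  obtains t where "t > 0" "x + t *\<^sub>R v \<in> interior B"
proof -
  define c where "c = - blinfun_apply (conormal M x) v"
  have c: "c > 0" using v by (simp add: c_def)
  have "v + c *\<^sub>R x \<in> tangent_space M x"
    using conormal[OF x] by (simp add: c_def blinfun.diff_right blinfun.scaleR_right)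
  then obtain \<gamma> e where \<gamma>: "e > 0" "\<gamma> ` {-e<..<e} \<subseteq> M" "\<gamma> 0 = x"
    "(\<gamma> has_vector_derivative (v + c *\<^sub>R x)) (at 0)"
    by (auto simp: tangent_space_def)
  \<comment> \<open>Solves x + t v = (1 - t c) \<gamma>(t) + t c r(t). The last summand compensates
    for contracting \<gamma>(t) instead of x.\<close>
  define r where "r t = (1/c) *\<^sub>R ((v + c *\<^sub>R x) - (\<gamma> t - \<gamma> 0) /\<^sub>R t) + (\<gamma> t - \<gamma> 0)" for t
  have "isCont \<gamma> 0" using \<gamma>(4) by (rule has_vector_derivative_continuous)
  then have "(r \<longlongrightarrow> (1/c) *\<^sub>R ((v + c *\<^sub>R x) - (v + c *\<^sub>R x)) + (\<gamma> 0 - \<gamma> 0)) (at 0)"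
    unfolding r_def isCont_def by (intro tendsto_intros has_vector_derivative_imp_quotient[OF \<gamma>(4)])
  then have "(r \<longlongrightarrow> 0) (at_right 0)"
    by (simp add: filterlim_at_split)
  then have "\<forall>\<^sub>F t in at_right 0. r t \<in> interior B"
    by (rule topological_tendstoD) (use zero_interior in auto)
  moreover have "\<forall>\<^sub>F t in at_right 0. 0 < t \<and> t < e" "\<forall>\<^sub>F t in at_right 0. 0 < t \<and> t < 1 / c"
    using \<gamma> c by (auto intro!: eventually_pos_less_at_right_0)
  ultimately have "\<forall>\<^sub>F t in at_right 0. r t \<in> interior B \<and> 0 < t \<and> t < e \<and> t < 1 / c"
    by eventually_elim auto
  then obtain t where t: "r t \<in> interior B" "0 < t" "t < e" "t < 1 / c"
    using eventually_happens'[OF trivial_limit_at_right_real] by blast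
  have tc: "t * c > 0" "t * c \<le> 1" using t c by (auto simp: field_simps)
  have "\<gamma> t \<in> M" using \<gamma>(2) t by auto
  then have "\<gamma> t \<in> B" using M_subset by auto
  then have "(1 - t * c) *\<^sub>R \<gamma> t + (t * c) *\<^sub>R r t \<in> interior B"
    by (intro convex_combination_interior convex t(1) tc)
  moreover have "(t * c) *\<^sub>R r t = t *\<^sub>R (v + c *\<^sub>R x) - (\<gamma> t - x) + (t * c) *\<^sub>R (\<gamma> t - x)"
    using t c \<gamma>(3) by (simp add: r_def scaleR_diff_right scaleR_add_right)
  ultimately have "(1 - t * c) *\<^sub>R \<gamma> t + (t *\<^sub>R (v + c *\<^sub>R x) - (\<gamma> t - x) + (t * c) *\<^sub>R (\<gamma> t - x)) \<in> interior B"
    by simp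
  then have "x + t *\<^sub>R v \<in> interior B"
    by (simp add: algebra_simps)
  then show ?thesis using that t by blast
qed

text \<open>The parameter t is a convex combination of r and s with positive weight on s. Both
  orders occur: the body point may be the start of the ray or a point beyond t.\<close>

lemma ray_before_exit_interior:
  assumes "x + r *\<^sub>R v \<in> B" "x + s *\<^sub>R v \<in> interior B" "r < t \<and> t \<le> s \<or> s \<le> t \<and> t < r"
  shows "x + t *\<^sub>R v \<in> interior B"
proof -
  define a where "a = (t - r) / (s - r)"
  have a: "0 < a" "a \<le> 1" "a * (s - r) = t - r" using assms(3) by (auto simp: a_def field_simps)
  have "(1 - a) *\<^sub>R (x + r *\<^sub>R v) + a *\<^sub>R (x + s *\<^sub>R v) \<in> interior B"
    by (intro convex_combination_interior convex assms a)
  moreover have "(1 - a) *\<^sub>R (x + r *\<^sub>R v) + a *\<^sub>R (x + s *\<^sub>R v) = x + (r + a * (s - r)) *\<^sub>R v"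
    by (simp add: algebra_simps)
  ultimately show ?thesis using a by simp
qed

text \<open>The exit is the largest parameter in the body, which exists by compactness. It is unique
  because a frontier point after the interior parameter t0 admits no later point of the body. This
  determines each step of the billiard.\<close>

lemma exit_ex1:
  assumes x: "x \<in> M" and v: "blinfun_apply (conormal M x) v < 0"
  shows "\<exists>!t. t > 0 \<and> x + t *\<^sub>R v \<in> M"
proof -
  obtain t0 where t0: "t0 > 0" "x + t0 *\<^sub>R v \<in> interior B"
    using inward_enters_interior[OF x v] .
  have xB: "x \<in> B" using x M_subset by auto
  have gt: "t0 < s" if "s > 0" "x + s *\<^sub>R v \<in> M" for s
    using ray_before_exit_interior[of x 0 v t0 s] xB t0 that by (force simp: M_iff not_less)
  have unique: "\<not> s < s'" if "s > 0" "x + s *\<^sub>R v \<in> M" "x + s' *\<^sub>R v \<in> B" for s s'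
    using ray_before_exit_interior[of x s' v t0 s] gt[OF that(1,2)] t0 that by (auto simp: M_iff)
  define A where "A = {t. 0 \<le> t \<and> x + t *\<^sub>R v \<in> B}"
  have "v \<noteq> 0" using v by auto
  have "compact A"
    unfolding compact_eq_bounded_closed
  proof
    obtain b where b: "\<And>y. y \<in> B \<Longrightarrow> norm y \<le> b" using bounded by (auto simp: bounded_iff)
    have "norm t \<le> (b + norm x) / norm v" if "t \<in> A" for t
    proof -
      have "\<bar>t\<bar> * norm v \<le> norm (x + t *\<^sub>R v) + norm x"
        using norm_triangle_ineq4[of "x + t *\<^sub>R v" x] by simp
      then show ?thesis using b[of "x + t *\<^sub>R v"] that \<open>v \<noteq> 0\<close> by (simp add: A_def field_simps)
    qed
    then show "bounded A" by (auto simp: bounded_iff)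
    have "A = {0..} \<inter> (\<lambda>t. x + t *\<^sub>R v) -` B" by (auto simp: A_def)
    moreover have "closed ((\<lambda>t. x + t *\<^sub>R v) -` B)"
      by (intro closed_vimage closed continuous_intros)
    ultimately show "closed A" by auto
  qed
  moreover have "t0 \<in> A" using t0 interior_subset by (auto simp: A_def)
  ultimately obtain T where T: "T \<in> A" "\<And>t. t \<in> A \<Longrightarrow> t \<le> T"
    using compact_attains_sup[of A] by auto
  then have "T > 0" using \<open>t0 \<in> A\<close> t0(1) by force
  have "x + T *\<^sub>R v \<notin> interior B"
  proof
    assume "x + T *\<^sub>R v \<in> interior B"
    have "((\<lambda>t. x + t *\<^sub>R v) \<longlongrightarrow> x + T *\<^sub>R v) (at_right T)"
      by (intro tendsto_intros)
    then have "\<forall>\<^sub>F t in at_right T. x + t *\<^sub>R v \<in> interior B"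
      by (rule topological_tendstoD) (use \<open>x + T *\<^sub>R v \<in> interior B\<close> in auto)
    then have "\<forall>\<^sub>F t in at_right T. x + t *\<^sub>R v \<in> interior B \<and> T < t"
      by (intro eventually_conj) (auto simp: eventually_at_filter)
    then obtain t where "x + t *\<^sub>R v \<in> interior B" "T < t"
      using eventually_happens'[OF trivial_limit_at_right_real] by blast
    then show False using T(2)[of t] \<open>T > 0\<close> interior_subset by (force simp: A_def)
  qed
  then have TM: "x + T *\<^sub>R v \<in> M" using T(1) by (simp add: M_iff A_def)
  show ?thesis
  proof (rule ex1I[of _ T])
    fix s assume "0 < s \<and> x + s *\<^sub>R v \<in> M"
    then show "s = T"
      using unique[of s T] unique[of T s] TM \<open>T > 0\<close> M_subset by force
  qed (use TM \<open>T > 0\<close> in auto)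
qed

text \<open>Along the ray the conormal at the exit is affine in the parameter, below 1 at an earlier
  interior point and equal to 1 at the exit, hence increasing. The sign feeds the next step of the
  billiard.\<close>

lemma exit_outward:
  assumes x: "x \<in> M" and v: "blinfun_apply (conormal M x) v < 0"
    and t: "t > 0" "x + t *\<^sub>R v \<in> M"
  shows "blinfun_apply (conormal M (x + t *\<^sub>R v)) v > 0"
proof -
  obtain t0 where t0: "t0 > 0" "x + t0 *\<^sub>R v \<in> interior B"
    using inward_enters_interior[OF x v] .
  have "t0 < t"
    using ray_before_exit_interior[of x 0 v t0 t] x M_subset t0 t by (force simp: M_iff not_less)
  moreover have "blinfun_apply (conormal M (x + t *\<^sub>R v)) (x + t0 *\<^sub>R v)
      < blinfun_apply (conormal M (x + t *\<^sub>R v)) (x + t *\<^sub>R v)"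
    using conormal_less_1[OF t(2) t0(2)] conormal[OF t(2)] by simp
  then have "t0 * blinfun_apply (conormal M (x + t *\<^sub>R v)) v < t * blinfun_apply (conormal M (x + t *\<^sub>R v)) v"
    by (simp add: blinfun.add_right blinfun.scaleR_right)
  ultimately show ?thesis
    by (metis linorder_not_le mult_right_mono_neg order_less_imp_le)
qed

end

section \<open>The bidual and the Legendre transform on the dual space\<close>

lemma dual_functional_is_evaluation:
  fixes F :: "'v::euclidean_space dual \<Rightarrow>\<^sub>L real"
  obtains v where "\<And>l. blinfun_apply F l = blinfun_apply l v"
proof
  fix l :: "'v dual"
  \<comment> \<open>Expansion of l in the dual basis; the representing vector then has the values of
    F on that basis as coordinates.\<close>
  have "l = (\<Sum>b\<in>Basis. blinfun_apply l b *\<^sub>R blinfun_inner_left b)"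
  proof (rule blinfun_eqI)
    fix v
    have "blinfun_apply l v = blinfun_apply l (\<Sum>b\<in>Basis. (v \<bullet> b) *\<^sub>R b)"
      by (simp only: euclidean_representation)
    then show "blinfun_apply l v = blinfun_apply (\<Sum>b\<in>Basis. blinfun_apply l b *\<^sub>R blinfun_inner_left b) v"
      by (simp add: blinfun.sum_right blinfun.sum_left blinfun.scaleR_right blinfun.scaleR_left mult.commute inner_commute)
  qed
  then have "blinfun_apply F l = (\<Sum>b\<in>Basis. blinfun_apply l b * blinfun_apply F (blinfun_inner_left b))"
    by (metis (mono_tags, lifting) blinfun.sum_right blinfun.scaleR_right real_scaleR_def sum.cong)
  then show "blinfun_apply F l = blinfun_apply l (\<Sum>b\<in>Basis. blinfun_apply F (blinfun_inner_left b) *\<^sub>R b)"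
    by (simp add: blinfun.sum_right blinfun.scaleR_right mult.commute)
qed

lemma dual_separates_points:
  fixes v w :: "'v::euclidean_space"
  assumes "\<And>l :: 'v dual. blinfun_apply l v = blinfun_apply l w"
  shows "v = w"
proof (rule euclidean_eqI)
  fix b
  show "v \<bullet> b = w \<bullet> b"
    using assms[of "blinfun_inner_left b"] by (simp add: inner_commute)
qed

text \<open>The conormal is evaluation at some vector. Any competing vector induces a functional
  with the same kernel and normalization, and functionals separate vectors.\<close>

lemma legendre_dual_apply:
  fixes B :: "'v::euclidean_space dual set"
  assumes "smooth_convex_body B" "p \<in> frontier B"
  shows "blinfun_apply l (legendre_dual (frontier B) p) = blinfun_apply (conormal (frontier B) p) l"
proof -
  interpret smooth_convex_body B by fact
  obtain v where v: "\<And>l. blinfun_apply (conormal M p) l = blinfun_apply l v"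
    by (rule dual_functional_is_evaluation[of "conormal M p"]) blast
  have "legendre_dual M p = v"
    unfolding legendre_dual_def
  proof (rule the_equality)
    show "{l. blinfun_apply l v = 0} = tangent_space M p \<and> blinfun_apply p v = 1"
      using conormal[OF assms(2)] v by simp
    fix w assume w: "{l. blinfun_apply l w = 0} = tangent_space M p \<and> blinfun_apply p w = 1"
    define W where "W = Blinfun (\<lambda>l :: 'v dual. blinfun_apply l w)"
    have W: "blinfun_apply W l = blinfun_apply l w" for l
      unfolding W_def by (simp add: bounded_linear_Blinfun_apply blinfun.bounded_linear_left)
    have "conormal M p = W"
      by (rule conormal_eqI) (use w W in auto)
    with v W show "w = v"
      by (metis dual_separates_points)
  qed
  then show ?thesis using v by simp
qed

section \<open>Cyclic monotonicity\<close>

text \<open>The common value \<open>r\<^sub>0\<close> contributes a telescoping sum, which vanishes along a cycle;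
  the rest is quadratic in \<open>t\<close>.\<close>

lemma cyclic_sum_nonpos:
  fixes pr :: "'b::real_normed_vector \<Rightarrow> 'c::real_normed_vector \<Rightarrow> real"
  assumes bl: "bounded_bilinear pr"
    and \<rho>: "\<And>i. \<rho> i 0 = r0 \<and> (\<rho> i has_vector_derivative R i) (at 0)"
    and \<xi>: "\<And>i. \<xi> i 0 = x0 \<and> (\<xi> i has_vector_derivative N i) (at 0)"
    and closed: "\<xi> k = \<xi> 0"
    and mono: "\<And>i. \<forall>\<^sub>F t in at (0::real). pr (\<rho> i t) (\<xi> (Suc i) t - \<xi> i t) \<le> 0"
  shows "(\<Sum>i<k. pr (R i) (N (Suc i) - N i)) \<le> 0"
proof -
  interpret pr: bounded_bilinear pr by fact
  \<comment> \<open>Since all curves \<xi> start at x0, the summands are pr (\<rho> - r0) applied to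
    edges of the polygon, divided by t squared. This factor is positive for either sign of
    t.\<close>
  define F where "F t = (\<Sum>i<k. pr ((\<rho> i t - \<rho> i 0) /\<^sub>R t)
    ((\<xi> (Suc i) t - \<xi> (Suc i) 0) /\<^sub>R t - (\<xi> i t - \<xi> i 0) /\<^sub>R t))" for t :: real
  have "(F \<longlongrightarrow> (\<Sum>i<k. pr (R i) (N (Suc i) - N i))) (at 0)"
    unfolding F_def using \<rho> \<xi>
    by (intro tendsto_sum pr.tendsto tendsto_diff has_vector_derivative_imp_quotient) auto
  moreover have "\<forall>\<^sub>F t in at 0. F t \<le> 0"
  proof -
    have "\<forall>\<^sub>F t in at (0::real). \<forall>i\<in>{..<k}. pr (\<rho> i t) (\<xi> (Suc i) t - \<xi> i t) \<le> 0"
      by (rule eventually_ball_finite) (use mono in auto)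
    then show ?thesis
    proof eventually_elim
      case (elim t)
      have "F t = (\<Sum>i<k. inverse t * inverse t * (pr (\<rho> i t) (\<xi> (Suc i) t - \<xi> i t)
          - (pr r0 (\<xi> (Suc i) t) - pr r0 (\<xi> i t))))"
        unfolding F_def using \<rho> \<xi>
        by (intro sum.cong refl)
          (simp add: scaleR_right_diff_distrib[symmetric] pr.scaleR_left pr.scaleR_right,
            simp add: pr.diff_left pr.diff_right)
      also have "\<dots> = inverse t * inverse t * ((\<Sum>i<k. pr (\<rho> i t) (\<xi> (Suc i) t - \<xi> i t))
          - (pr r0 (\<xi> k t) - pr r0 (\<xi> 0 t)))"
        using sum_lessThan_telescope[of "\<lambda>i. pr r0 (\<xi> i t)" k]
        by (simp only: sum_distrib_left[symmetric] sum_subtractf)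
      also have "\<dots> \<le> 0"
        using sum_nonpos[of "{..<k}" "\<lambda>i. pr (\<rho> i t) (\<xi> (Suc i) t - \<xi> i t)"] elim closed
        by (simp add: mult_nonneg_nonpos)
      finally show ?case .
    qed
  qed
  ultimately show ?thesis
    by (rule tendsto_upperbound) simp
qed

text \<open>Each product of a and b is at most a squared plus b squared, which will be the squared
  edge length 2 - 2 cos \<theta> of a regular polygon.\<close>

lemma quadratic_form_bound:
  fixes a b x y z w :: real
  shows "\<bar>a * a * x + a * b * y + b * a * z + b * b * w\<bar> \<le> (a\<^sup>2 + b\<^sup>2) * (\<bar>x\<bar> + \<bar>y\<bar> + \<bar>z\<bar> + \<bar>w\<bar>)"
proof -
  have ab: "\<bar>a * b\<bar> \<le> a\<^sup>2 + b\<^sup>2"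
  proof -
    have "2 * \<bar>a * b\<bar> \<le> a\<^sup>2 + b\<^sup>2"
      using sum_squares_bound[of "\<bar>a\<bar>" "\<bar>b\<bar>"] by (simp add: abs_mult)
    then show ?thesis by simp
  qed
  have "\<bar>a * a * x\<bar> \<le> (a\<^sup>2 + b\<^sup>2) * \<bar>x\<bar>" "\<bar>b * b * w\<bar> \<le> (a\<^sup>2 + b\<^sup>2) * \<bar>w\<bar>"
    "\<bar>a * b * y\<bar> \<le> (a\<^sup>2 + b\<^sup>2) * \<bar>y\<bar>" "\<bar>b * a * z\<bar> \<le> (a\<^sup>2 + b\<^sup>2) * \<bar>z\<bar>"
    unfolding abs_mult[of "_ * _"] by (intro mult_right_mono; use ab in \<open>simp add: power2_eq_square mult.commute abs_mult\<close>)+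
  moreover have "\<bar>p + q + r + s\<bar> \<le> \<bar>p\<bar> + \<bar>q\<bar> + \<bar>r\<bar> + \<bar>s\<bar>" for p q r s :: real
    by linarith
  ultimately show ?thesis
    unfolding distrib_left by (meson add_mono order_trans)
qed

text \<open>Cyclic monotonicity along a regular \<open>k\<close>-gon, whose antisymmetric part sums to
  \<open>k sin (2\<pi>/k)\<close> times the difference while the symmetric part is \<open>O(1/k)\<close>.\<close>

lemma cyclically_monotone_imp_symmetric:
  fixes B :: "'a::real_vector \<Rightarrow> 'a \<Rightarrow> real"
  assumes bil: "\<And>a b c d. B (a *\<^sub>R u + b *\<^sub>R w) (c *\<^sub>R u + d *\<^sub>R w)
      = a * c * B u u + a * d * B u w + b * c * B w u + b * d * B w w"
    and cyc: "\<And>k a b. a k = a 0 \<Longrightarrow> b k = b 0 \<Longrightarrow>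
      (\<Sum>i<k::nat. B (a i *\<^sub>R u + b i *\<^sub>R w)
        ((a (Suc i) - a i) *\<^sub>R u + (b (Suc i) - b i) *\<^sub>R w)) \<le> 0"
  shows "B u w \<le> B w u"
proof -
  define M where "M = \<bar>B u u\<bar> + \<bar>B u w\<bar> + \<bar>B w u\<bar> + \<bar>B w w\<bar>"
  have ineq: "sin \<theta> * (B u w - B w u) \<le> (2 - 2 * cos \<theta>) * M"
    if k: "k > 0" and \<theta>: "\<theta> = 2 * pi / real k" for k \<theta>
  proof -
    define a b where "a i = cos (real i * \<theta>)" and "b i = sin (real i * \<theta>)" for i
    have k\<theta>: "real k * \<theta> = 2 * pi" using k \<theta> by simp
    \<comment> \<open>The diagonal values B(h, h) at the vertices h = a u + b w; their differences
      telescope to 0 around the polygon.\<close>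
    define q where "q i = a i * a i * B u u + a i * b i * B u w + b i * a i * B w u + b i * b i * B w w" for i
    have step: "2 * B (a i *\<^sub>R u + b i *\<^sub>R w) ((a (Suc i) - a i) *\<^sub>R u + (b (Suc i) - b i) *\<^sub>R w)
        \<ge> sin \<theta> * (B u w - B w u) - (2 - 2 * cos \<theta>) * M + (q (Suc i) - q i)" for i
    proof -
      have S: "real (Suc i) * \<theta> = real i * \<theta> + \<theta>" by (simp add: algebra_simps)
      have S: "a (Suc i) = cos (real i * \<theta> + \<theta>)" "b (Suc i) = sin (real i * \<theta> + \<theta>)"
        by (simp_all only: a_def b_def S)
      have s1: "a i * b (Suc i) - b i * a (Suc i) = sin \<theta>"
        using sin_diff[of "real i * \<theta> + \<theta>" "real i * \<theta>"] unfolding S by (simp add: a_def b_def mult.commute)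
      have s2: "(a (Suc i) - a i)\<^sup>2 + (b (Suc i) - b i)\<^sup>2 = 2 - 2 * cos \<theta>"
      proof -
        have "cos \<theta> = a (Suc i) * a i + b (Suc i) * b i"
          using cos_diff[of "real i * \<theta> + \<theta>" "real i * \<theta>"] unfolding S by (simp add: a_def b_def)
        moreover have "(a i)\<^sup>2 + (b i)\<^sup>2 = 1" "(a (Suc i))\<^sup>2 + (b (Suc i))\<^sup>2 = 1"
          by (simp_all add: a_def b_def)
        ultimately show ?thesis
          unfolding power2_diff by linarith
      qed
      let ?da = "a (Suc i) - a i" and ?db = "b (Suc i) - b i"
      have "?da * ?da * B u u + ?da * ?db * B u w + ?db * ?da * B w u + ?db * ?db * B w w \<le> (2 - 2 * cos \<theta>) * M"
        using quadratic_form_bound[of ?da "B u u" ?db "B u w" "B w u" "B w w"] s2 by (simp add: M_def)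
      \<comment> \<open>For consecutive vertices h, h' this is 2 B(h, h' - h) = (B(h, h') - B(h',
        h)) + (B(h', h') - B(h, h)) - B(h' - h, h' - h). The first bracket is a determinant, equal
        to sin \<theta>, times the asymmetry.\<close>
      moreover have "2 * B (a i *\<^sub>R u + b i *\<^sub>R w) (?da *\<^sub>R u + ?db *\<^sub>R w)
          = (a i * b (Suc i) - b i * a (Suc i)) * (B u w - B w u) + (q (Suc i) - q i)
            - (?da * ?da * B u u + ?da * ?db * B u w + ?db * ?da * B w u + ?db * ?db * B w w)"
        unfolding bil q_def by (simp add: algebra_simps)
      ultimately show ?thesis unfolding s1 by linarith
    qed
    have ak: "a k = a 0" "b k = b 0" unfolding a_def b_def k\<theta> by simp_all
    have "(\<Sum>i<k. sin \<theta> * (B u w - B w u) - (2 - 2 * cos \<theta>) * M + (q (Suc i) - q i))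
        \<le> (\<Sum>i<k. 2 * B (a i *\<^sub>R u + b i *\<^sub>R w) ((a (Suc i) - a i) *\<^sub>R u + (b (Suc i) - b i) *\<^sub>R w))"
      by (rule sum_mono) (rule step)
    also have "\<dots> \<le> 0"
      using cyc[of a k b] ak by (simp add: sum_distrib_left[symmetric])
    finally have "real k * (sin \<theta> * (B u w - B w u) - (2 - 2 * cos \<theta>) * M) + (q k - q 0) \<le> 0"
      by (simp only: sum.distrib sum_lessThan_telescope) simp
    moreover have "q k = q 0" by (simp add: q_def ak)
    ultimately have "real k * (sin \<theta> * (B u w - B w u) - (2 - 2 * cos \<theta>) * M) \<le> 0" by simp
    then show ?thesis using k by (simp add: mult_le_0_iff)
  qed
  have "(\<lambda>k. real k * (sin (2 * pi / real k) * (B u w - B w u))) \<longlonglongrightarrow> 2 * pi * (B u w - B w u)"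
    by real_asymp
  moreover have "(\<lambda>k. real k * ((2 - 2 * cos (2 * pi / real k)) * M)) \<longlonglongrightarrow> 0"
    by real_asymp
  moreover have "\<exists>N. \<forall>k\<ge>N. real k * (sin (2 * pi / real k) * (B u w - B w u))
      \<le> real k * ((2 - 2 * cos (2 * pi / real k)) * M)"
  proof (intro exI[of _ 1] allI impI)
    fix k :: nat assume "1 \<le> k"
    then show "real k * (sin (2 * pi / real k) * (B u w - B w u))
      \<le> real k * ((2 - 2 * cos (2 * pi / real k)) * M)"
      by (intro mult_left_mono ineq) auto
  qed
  ultimately have "2 * pi * (B u w - B w u) \<le> 0"
    by (rule LIMSEQ_le)
  then show ?thesis
    using mult_pos_pos[of "2 * pi" "B u w - B w u"] pi_gt_zero by linarith
qed

text \<open>Symmetry of the second fundamental form without second derivatives: \<open>\<rho>\<close> plays the part of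
  an outer normal at the point \<open>\<xi>\<close> of a convex hypersurface.\<close>

lemma support_pairing_symmetric:
  fixes pr :: "'b::real_normed_vector \<Rightarrow> 'c::real_normed_vector \<Rightarrow> real" and H :: "'a::real_vector set"
  assumes bl: "bounded_bilinear pr" and R: "linear R" and N: "linear N" and H: "subspace H"
    and \<rho>: "\<And>h. h \<in> H \<Longrightarrow> \<rho> h 0 = r0 \<and> (\<rho> h has_vector_derivative R h) (at (0::real))"
    and \<xi>: "\<And>h. h \<in> H \<Longrightarrow> \<xi> h 0 = x0 \<and> (\<xi> h has_vector_derivative N h) (at (0::real))"
    and mono: "\<And>h k. h \<in> H \<Longrightarrow> k \<in> H \<Longrightarrow> \<forall>\<^sub>F t in at 0. pr (\<rho> h t) (\<xi> k t - \<xi> h t) \<le> 0"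
    and "u \<in> H" "w \<in> H"
  shows "pr (R u) (N w) = pr (R w) (N u)"
proof -
  interpret pr: bounded_bilinear pr by fact
  \<comment> \<open>Proved for every pair, so that exchanging u and w yields the reverse
    inequality.\<close>
  have "pr (R u) (N w) \<le> pr (R w) (N u)" if uw: "u \<in> H" "w \<in> H" for u w
  proof (rule cyclically_monotone_imp_symmetric[of "\<lambda>h k. pr (R h) (N k)"])
    fix a b c d
    show "pr (R (a *\<^sub>R u + b *\<^sub>R w)) (N (c *\<^sub>R u + d *\<^sub>R w)) =
        a * c * pr (R u) (N u) + a * d * pr (R u) (N w) + b * c * pr (R w) (N u) + b * d * pr (R w) (N w)"
      by (simp add: linear_add[OF R] linear_add[OF N] linear_scale[OF R] linear_scale[OF N]
          pr.add_left pr.add_right pr.scaleR_left pr.scaleR_right algebra_simps)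
  next
    fix k :: nat and a b :: "nat \<Rightarrow> real"
    assume ab: "a k = a 0" "b k = b 0"
    define h where "h i = a i *\<^sub>R u + b i *\<^sub>R w" for i
    have h: "h i \<in> H" for i
      using uw H by (simp add: h_def subspace_add subspace_scale)
    have "(\<Sum>i<k. pr (R (h i)) (N (h (Suc i)) - N (h i))) \<le> 0"
      by (rule cyclic_sum_nonpos[OF bl, where \<rho> = "\<lambda>i. \<rho> (h i)" and \<xi> = "\<lambda>i. \<xi> (h i)"])
        (use \<rho> \<xi> mono h ab in \<open>auto simp: h_def\<close>)
    moreover have "N (h (Suc i)) - N (h i) = N ((a (Suc i) - a i) *\<^sub>R u + (b (Suc i) - b i) *\<^sub>R w)" for i
      by (simp add: linear_diff[OF N, symmetric] h_def algebra_simps)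
    ultimately show "(\<Sum>i<k. pr (R (a i *\<^sub>R u + b i *\<^sub>R w))
        (N ((a (Suc i) - a i) *\<^sub>R u + (b (Suc i) - b i) *\<^sub>R w))) \<le> 0"
      by (simp add: h_def)
  qed
  then show ?thesis using assms(8,9) by (intro antisym)
qed

text \<open>The curve stays in S on an open set W around 0, the value at 0 itself being z. The chain
  rule applies within W, and openness removes the restriction.\<close>

lemma has_vector_derivative_compose_within:
  fixes \<zeta> :: "real \<Rightarrow> 'a::real_normed_vector" and \<phi> :: "'a \<Rightarrow> 'b::real_normed_vector"
  assumes \<phi>: "(\<phi> has_derivative D) (at z within S)" and z: "\<zeta> 0 = z" "z \<in> S"
    and \<zeta>: "(\<zeta> has_vector_derivative h) (at 0)" and ev: "\<forall>\<^sub>F t in at 0. \<zeta> t \<in> S"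
  shows "((\<lambda>t. \<phi> (\<zeta> t)) has_vector_derivative D h) (at 0)"
proof -
  obtain W where W: "open W" "0 \<in> W" "\<And>t. t \<in> W \<Longrightarrow> t \<noteq> 0 \<Longrightarrow> \<zeta> t \<in> S"
    using ev unfolding eventually_at_topological by auto
  have "\<zeta> ` W \<subseteq> S" using W z by (metis image_subsetI)
  then have "(\<phi> has_derivative D) (at (\<zeta> 0) within \<zeta> ` W)"
    using \<phi> z by (auto intro: has_derivative_subset)
  moreover have "(\<zeta> has_derivative (\<lambda>t. t *\<^sub>R h)) (at 0 within W)"
    using \<zeta> by (auto simp: has_vector_derivative_def intro: has_derivative_at_withinI)
  ultimately have "((\<phi> \<circ> \<zeta>) has_derivative (D \<circ> (\<lambda>t. t *\<^sub>R h))) (at 0 within W)"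
    by (intro diff_chain_within)
  moreover have "D \<circ> (\<lambda>t. t *\<^sub>R h) = (\<lambda>t. t *\<^sub>R D h)"
    using has_derivative_linear[OF \<phi>] by (simp add: comp_def linear_scale)
  ultimately show ?thesis
    using at_within_open[OF W(2,1)] by (simp add: has_vector_derivative_def comp_def)
qed

section \<open>The billiard map\<close>

lemma C1_hypersurface_body:
  assumes "C1_hypersurface M" "0 \<in> hypersurface_interior M"
  obtains B where "smooth_convex_body B" "frontier B = M"
proof -
  obtain B where "convex_body B" "frontier B = M" "0 \<in> interior B"
    using assms(2) by (auto simp: hypersurface_interior_def)
  moreover from this have "smooth_convex_body B"
    using assms(1)
    by (auto simp: smooth_convex_body_def convex_body_def compact_imp_closed compact_imp_bounded)
  ultimately show ?thesis using that by blast
qed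

text \<open>Curves project to the factors. This places a tangent vector in both kernels; curves for
  it are then rebuilt factorwise in \<open>phase_space_curve\<close>.\<close>

lemma tangent_space_Times:
  "tangent_space (M \<times> N) z \<subseteq> tangent_space M (fst z) \<times> tangent_space N (snd z)"
proof
  fix v assume "v \<in> tangent_space (M \<times> N) z"
  then obtain \<gamma> e d where \<gamma>: "e > 0" "\<gamma> ` {-e<..<e} \<subseteq> M \<times> N" "\<gamma> 0 = z"
    "(\<gamma> has_vector_derivative v) (at 0)"
    and d: "\<And>t. t \<in> {-e<..<e} \<Longrightarrow> (\<gamma> has_vector_derivative d t) (at t)" "continuous_on {-e<..<e} d"
    unfolding tangent_space_def C1_differentiable_on_def by blast
  have mem: "\<gamma> t \<in> M \<times> N" if "t \<in> {-e<..<e}" for t using \<gamma>(2) that by blast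
  have "fst v \<in> tangent_space M (fst z)"
    unfolding tangent_space_def C1_differentiable_on_def using \<gamma> d mem
    by (intro CollectI exI[of _ "\<lambda>t. fst (\<gamma> t)"] exI[of _ e] conjI exI[of _ "\<lambda>t. fst (d t)"] ballI
        bounded_linear.has_vector_derivative[OF bounded_linear_fst] continuous_on_fst)
      (auto simp: mem_Times_iff)
  moreover have "snd v \<in> tangent_space N (snd z)"
    unfolding tangent_space_def C1_differentiable_on_def using \<gamma> d mem
    by (intro CollectI exI[of _ "\<lambda>t. snd (\<gamma> t)"] exI[of _ e] conjI exI[of _ "\<lambda>t. snd (d t)"] ballI
        bounded_linear.has_vector_derivative[OF bounded_linear_snd] continuous_on_snd)
      (auto simp: mem_Times_iff)
  ultimately show "v \<in> tangent_space M (fst z) \<times> tangent_space N (snd z)"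
    by (simp add: mem_Times_iff)
qed

locale minkowski_billiard =
  Q: smooth_convex_body BQ + P: smooth_convex_body BP
  for BQ :: "'v::euclidean_space set" and BP :: "'v dual set"
begin

abbreviation "Q \<equiv> frontier BQ"
abbreviation "P \<equiv> frontier BP"
abbreviation "\<phi> \<equiv> minkowski_billiard_map Q P"

lemma legendre_dual_eq:
  "p \<in> P \<Longrightarrow> blinfun_apply l (legendre_dual P p) = blinfun_apply (conormal P p) l"
  by (rule legendre_dual_apply[OF P.smooth_convex_body_axioms])

text \<open>Through \<open>legendre_dual_eq\<close> the same number expresses that the velocity is
  inward for Q at q, and in this form it is visibly continuous in z.\<close>

lemma phase_space_iff:
  "z \<in> phase_space Q P \<longleftrightarrow> fst z \<in> Q \<and> snd z \<in> P \<and>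
    blinfun_apply (conormal P (snd z)) (conormal Q (fst z)) < 0"
  by (cases z) (auto simp: phase_space_def legendre_eq_conormal legendre_dual_eq)

text \<open>The phase space inequality makes the velocity inward at q, so the ray exits at q1.
  \<open>exit_outward\<close> there makes -L(q1) inward at p, so the second ray exits at p1.
  \<open>exit_outward\<close> at p1 is exactly the inequality for (q1, p1).\<close>

lemma billiard_map:
  assumes z: "z \<in> phase_space Q P"
  obtains c d where "c > 0" "d > 0" "\<phi> z \<in> phase_space Q P"
    "fst (\<phi> z) - fst z = c *\<^sub>R legendre_dual P (snd z)"
    "snd (\<phi> z) - snd z = - d *\<^sub>R conormal Q (fst (\<phi> z))"
proof -
  obtain q p where z_eq: "z = (q, p)" by (cases z)
  have q: "q \<in> Q" and p: "p \<in> P" using z by (auto simp: phase_space_iff z_eq)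
  define v where "v = legendre_dual P p"
  have v: "blinfun_apply (conormal Q q) v < 0"
    using z p by (simp add: v_def legendre_dual_eq phase_space_iff z_eq)
  obtain c where c: "c > 0" "q + c *\<^sub>R v \<in> Q" and c_unique: "\<And>t. t > 0 \<Longrightarrow> q + t *\<^sub>R v \<in> Q \<Longrightarrow> t = c"
    using Q.exit_ex1[OF q v] by blast
  define q1 where "q1 = q + c *\<^sub>R v"
  define l where "l = - conormal Q q1"
  have l: "blinfun_apply (conormal P p) l < 0"
    using Q.exit_outward[OF q v c] legendre_dual_eq[OF p]
    by (simp add: l_def q1_def v_def blinfun.minus_right)
  obtain d where d: "d > 0" "p + d *\<^sub>R l \<in> P" and d_unique: "\<And>t. t > 0 \<Longrightarrow> p + t *\<^sub>R l \<in> P \<Longrightarrow> t = d"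
    using P.exit_ex1[OF p l] by blast
  define p1 where "p1 = p + d *\<^sub>R l"
  have "\<phi> z = (q1, p1)"
    unfolding minkowski_billiard_map_def z_eq prod.case
  proof (rule the_equality)
    show "case (q1, p1) of (q1, p1) \<Rightarrow> q1 \<in> Q \<and> p1 \<in> P \<and> q1 - q \<sim>\<^sub>+ legendre_dual P p \<and>
        p1 - p \<sim>\<^sub>+ - legendre Q q1"
      using c d by (auto simp: q1_def p1_def v_def l_def pos_multiple_def legendre_eq_conormal)
    fix y assume y: "case y of (q1, p1) \<Rightarrow> q1 \<in> Q \<and> p1 \<in> P \<and> q1 - q \<sim>\<^sub>+ legendre_dual P p \<and>
        p1 - p \<sim>\<^sub>+ - legendre Q q1"
    obtain q2 p2 where y_eq: "y = (q2, p2)" by (cases y)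
    obtain s t where s: "s > 0" "q2 = q + s *\<^sub>R v" and t: "t > 0" "p2 = p + t *\<^sub>R - conormal Q q2"
      using y unfolding y_eq prod.case pos_multiple_def v_def legendre_eq_conormal
      by (metis add.commute diff_add_cancel)
    \<comment> \<open>Any candidate lies on the same first ray, so q1 is forced; only then are the
      second rays known to agree.\<close>
    have "q2 = q1" using s y c_unique[of s] by (simp add: y_eq q1_def)
    moreover have "p2 = p1"
      using t y d_unique[of t] unfolding \<open>q2 = q1\<close> by (simp add: y_eq p1_def l_def)
    ultimately show "y = (q1, p1)" by (simp add: y_eq)
  qed
  moreover have "(q1, p1) \<in> phase_space Q P"
    using P.exit_outward[OF p l d] c(2) d(2)
    by (simp add: phase_space_iff q1_def[symmetric] p1_def[symmetric])
      (simp add: l_def blinfun.minus_right)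
  ultimately show ?thesis
    using that[of c d] c d by (simp add: z_eq q1_def p1_def l_def v_def)
qed

text \<open>Tangent curves in the two factors are paired; the strict inequality survives for small t
  by continuity of both conormals.\<close>

lemma phase_space_curve:
  assumes z: "z \<in> phase_space Q P"
    and h: "blinfun_apply (conormal Q (fst z)) (fst h) = 0" "blinfun_apply (conormal P (snd z)) (snd h) = 0"
  obtains \<zeta> where "\<zeta> 0 = z" "(\<zeta> has_vector_derivative h) (at 0)"
    "\<forall>\<^sub>F t in at 0. \<zeta> t \<in> phase_space Q P"
proof -
  have q: "fst z \<in> Q" and p: "snd z \<in> P" using z by (auto simp: phase_space_iff)
  obtain \<alpha> where \<alpha>: "\<alpha> 0 = fst z" "(\<alpha> has_vector_derivative fst h) (at 0)" "\<forall>\<^sub>F t in at 0. \<alpha> t \<in> Q"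
    using Q.tangent_curve[OF q h(1)] by blast
  obtain \<beta> where \<beta>: "\<beta> 0 = snd z" "(\<beta> has_vector_derivative snd h) (at 0)" "\<forall>\<^sub>F t in at 0. \<beta> t \<in> P"
    using P.tangent_curve[OF p h(2)] by blast
  have "(\<alpha> \<longlongrightarrow> fst z) (at 0)" "(\<beta> \<longlongrightarrow> snd z) (at 0)"
    using has_vector_derivative_continuous[OF \<alpha>(2)] has_vector_derivative_continuous[OF \<beta>(2)] \<alpha>(1) \<beta>(1)
    by (auto simp: isCont_def)
  then have "((\<lambda>t. blinfun_apply (conormal P (\<beta> t)) (conormal Q (\<alpha> t))) \<longlongrightarrow>
      blinfun_apply (conormal P (snd z)) (conormal Q (fst z))) (at 0)"
    using continuous_on_tendsto_compose[OF Q.continuous_on_conormal _ q \<alpha>(3)]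
      continuous_on_tendsto_compose[OF P.continuous_on_conormal _ p \<beta>(3)]
    by (intro tendsto_intros)
  then have "\<forall>\<^sub>F t in at 0. blinfun_apply (conormal P (\<beta> t)) (conormal Q (\<alpha> t)) < 0"
    by (rule order_tendstoD) (use z in \<open>simp add: phase_space_iff\<close>)
  with \<alpha>(3) \<beta>(3) have "\<forall>\<^sub>F t in at 0. (\<alpha> t, \<beta> t) \<in> phase_space Q P"
    by eventually_elim (simp add: phase_space_iff)
  then show ?thesis
    using that[of "\<lambda>t. (\<alpha> t, \<beta> t)"] \<alpha> \<beta> has_vector_derivative_Pair[OF \<alpha>(2) \<beta>(2)] by simp
qed

lemma symplectic: "symplectic_on (Q \<times> P) (phase_space Q P) \<phi>"
  unfolding symplectic_on_def
proof (intro conjI ballI allI impI funcsetI)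
  show "\<phi> z \<in> phase_space Q P" if "z \<in> phase_space Q P" for z
    using billiard_map[OF that] by blast
next
  fix z D u w
  assume z: "z \<in> phase_space Q P" and D: "(\<phi> has_derivative D) (at z within phase_space Q P)"
    and uw: "u \<in> tangent_space (Q \<times> P) z" "w \<in> tangent_space (Q \<times> P) z"
  \<comment> \<open>The product of the two tangent hyperplanes, evidently a subspace, over which the
    symmetry argument can run.\<close>
  define H where "H = {h. blinfun_apply (conormal Q (fst z)) (fst h) = 0 \<and>
    blinfun_apply (conormal P (snd z)) (snd h) = 0}"
  have H: "subspace H"
    by (auto simp: H_def subspace_def blinfun.add_right blinfun.scaleR_right)
  have "tangent_space (Q \<times> P) z \<subseteq> H"
    using tangent_space_Times[of Q P z] z Q.conormal[of "fst z"] P.conormal[of "snd z"]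
    by (auto simp: H_def phase_space_iff)
  then have uwH: "u \<in> H" "w \<in> H" using uw by auto
  have "\<exists>\<zeta>. \<forall>h\<in>H. \<zeta> h 0 = z \<and> (\<zeta> h has_vector_derivative h) (at 0) \<and>
      (\<forall>\<^sub>F t in at 0. \<zeta> h t \<in> phase_space Q P)"
    by (rule bchoice) (use phase_space_curve[OF z] in \<open>unfold H_def, blast\<close>)
  then obtain \<zeta> where \<zeta>: "\<And>h. h \<in> H \<Longrightarrow> \<zeta> h 0 = z"
    "\<And>h. h \<in> H \<Longrightarrow> (\<zeta> h has_vector_derivative h) (at 0)"
    "\<And>h. h \<in> H \<Longrightarrow> \<forall>\<^sub>F t in at 0. \<zeta> h t \<in> phase_space Q P"
    by blast
  have \<phi>\<zeta>: "((\<lambda>t. \<phi> (\<zeta> h t)) has_vector_derivative D h) (at 0)" if "h \<in> H" for h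
    using has_vector_derivative_compose_within[OF D \<zeta>(1)[OF that] z \<zeta>(2,3)[OF that]] .
  note fst_deriv = bounded_linear.has_vector_derivative[OF bounded_linear_fst]
  note snd_deriv = bounded_linear.has_vector_derivative[OF bounded_linear_snd]
  have linD: "linear D" by (rule has_derivative_linear[OF D])
  have lin: "linear (\<lambda>h. fst (D h))" "linear (\<lambda>h. snd (D h))"
    using linear_compose[OF linD linear_fst] linear_compose[OF linD linear_snd] by (auto simp: comp_def)

  \<comment> \<open>The support inequality of P at p, scaled by the positive factor relating q1 - q
    to L(p).\<close>
  have ineq1: "blinfun_apply (p' - snd y) (fst (\<phi> y) - fst y) \<le> 0" if y: "y \<in> phase_space Q P" and "p' \<in> P" for y p'
  proof -
    obtain c where c: "c > 0" "fst (\<phi> y) - fst y = c *\<^sub>R legendre_dual P (snd y)"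
      using billiard_map[OF y] by metis
    have "snd y \<in> P" using y by (simp add: phase_space_iff)
    then have "blinfun_apply (p' - snd y) (legendre_dual P (snd y)) \<le> 0"
      using P.conormal_le_1[of "snd y" p'] P.conormal(2)[of "snd y"] \<open>p' \<in> P\<close> P.M_subset
      by (auto simp: legendre_dual_eq blinfun.diff_right)
    then show ?thesis using c by (simp add: blinfun.scaleR_right mult_nonneg_nonpos)
  qed
  \<comment> \<open>This is the vanishing of dp \<and> d(q1 - q) on H. The normal is a vector and
    the moving point a covector, hence the flipped pairing.\<close>
  have sym1: "blinfun_apply (snd w) (fst (D u) - fst u) = blinfun_apply (snd u) (fst (D w) - fst w)"
  proof (rule support_pairing_symmetric[OF _ _ _ H, where pr = "\<lambda>v l. blinfun_apply l v"
        and R = "\<lambda>h. fst (D h) - fst h" and N = snd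
        and \<rho> = "\<lambda>h t. fst (\<phi> (\<zeta> h t)) - fst (\<zeta> h t)" and \<xi> = "\<lambda>h t. snd (\<zeta> h t)"])
    show "bounded_bilinear (\<lambda>v (l :: 'v dual). blinfun_apply l v)"
      by (rule bounded_bilinear.flip[OF bounded_bilinear_blinfun_apply])
    show "linear (\<lambda>h. fst (D h) - fst h)" "linear (snd :: 'v \<times> 'v dual \<Rightarrow> _)"
      using lin linear_fst linear_snd by (auto intro: linear_compose_sub)
    show "\<forall>\<^sub>F t in at 0. blinfun_apply (snd (\<zeta> k t) - snd (\<zeta> h t)) (fst (\<phi> (\<zeta> h t)) - fst (\<zeta> h t)) \<le> 0"
      if "h \<in> H" "k \<in> H" for h k
      using \<zeta>(3)[OF that(1)] \<zeta>(3)[OF that(2)]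
      by eventually_elim (use ineq1 in \<open>auto simp: phase_space_iff\<close>)
  qed (use uwH \<zeta> in \<open>auto intro!: has_vector_derivative_diff fst_deriv snd_deriv \<phi>\<zeta>\<close>)

  have ineq2: "blinfun_apply (snd y - snd (\<phi> y)) (q' - fst (\<phi> y)) \<le> 0" if y: "y \<in> phase_space Q P" and "q' \<in> Q" for y q'
  proof -
    obtain d where d: "d > 0" "\<phi> y \<in> phase_space Q P" "snd (\<phi> y) - snd y = - d *\<^sub>R conormal Q (fst (\<phi> y))"
      using billiard_map[OF y] by metis
    \<comment> \<open>The outer normal at q1 is p - p1, not p1 - p, because the second step runs
      along -L(q1).\<close>
    have eq: "snd y - snd (\<phi> y) = d *\<^sub>R conormal Q (fst (\<phi> y))"
      using d(3) by (metis minus_diff_eq scaleR_minus_left minus_minus)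
    have "fst (\<phi> y) \<in> Q" using d(2) by (simp add: phase_space_iff)
    then have "blinfun_apply (conormal Q (fst (\<phi> y))) (q' - fst (\<phi> y)) \<le> 0"
      using Q.conormal_le_1[of "fst (\<phi> y)" q'] Q.conormal(2)[of "fst (\<phi> y)"] \<open>q' \<in> Q\<close> Q.M_subset
      by (auto simp: blinfun.diff_right)
    then show ?thesis using d(1) by (simp add: eq blinfun.scaleR_left mult_nonneg_nonpos)
  qed
  \<comment> \<open>The vanishing of d(p - p1) \<and> dq1, with the image point q1 as the moving
    point.\<close>
  have sym2: "blinfun_apply (snd u - snd (D u)) (fst (D w)) = blinfun_apply (snd w - snd (D w)) (fst (D u))"
  proof (rule support_pairing_symmetric[OF bounded_bilinear_blinfun_apply _ _ H,
        where R = "\<lambda>h. snd h - snd (D h)" and N = "\<lambda>h. fst (D h)"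
        and \<rho> = "\<lambda>h t. snd (\<zeta> h t) - snd (\<phi> (\<zeta> h t))" and \<xi> = "\<lambda>h t. fst (\<phi> (\<zeta> h t))"])
    show "linear (\<lambda>h. snd h - snd (D h))" "linear (\<lambda>h. fst (D h))"
      using lin linear_snd by (auto intro: linear_compose_sub)
    show "\<forall>\<^sub>F t in at 0. blinfun_apply (snd (\<zeta> h t) - snd (\<phi> (\<zeta> h t))) (fst (\<phi> (\<zeta> k t)) - fst (\<phi> (\<zeta> h t))) \<le> 0"
      if "h \<in> H" "k \<in> H" for h k
      using \<zeta>(3)[OF that(1)] \<zeta>(3)[OF that(2)]
    proof eventually_elim
      case (elim t)
      have "fst (\<phi> (\<zeta> k t)) \<in> Q"
        using billiard_map[OF elim(2)] phase_space_iff by metis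
      then show ?case using ineq2[OF elim(1)] by simp
    qed
  qed (use uwH \<zeta> in \<open>auto intro!: has_vector_derivative_diff fst_deriv snd_deriv \<phi>\<zeta>\<close>)

  \<comment> \<open>By \<open>sym1\<close>, dq \<and> dp equals dq1 \<and> dp; by
    \<open>sym2\<close>, the latter equals dq1 \<and> dp1.\<close>
  show "canonical_form (D u) (D w) = canonical_form u w"
    using sym1 sym2 by (simp add: canonical_form_eq_pairing blinfun.diff_left blinfun.diff_right)
qed

end

theorem theorem2:
  fixes Q :: "'v::euclidean_space set" and P :: "'v dual set"
  assumes "strictly_convex_hypersurface Q" and "C1_hypersurface Q"
    and "0 \<in> hypersurface_interior Q"
    and "strictly_convex_hypersurface P" and "C1_hypersurface P"
    and "0 \<in> hypersurface_interior P"
  shows "symplectic_on (Q \<times> P) (phase_space Q P) (minkowski_billiard_map Q P)"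
proof -
  obtain BQ where BQ: "smooth_convex_body BQ" "frontier BQ = Q"
    using C1_hypersurface_body[OF assms(2,3)] .
  obtain BP where BP: "smooth_convex_body BP" "frontier BP = P"
    using C1_hypersurface_body[OF assms(5,6)] .
  interpret minkowski_billiard BQ BP
    using BQ(1) BP(1) by (simp add: minkowski_billiard_def)
  show ?thesis using symplectic BQ(2) BP(2) by simp
qed

end
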